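(* Let $S=\mathrm{SING}_{n,m}\subseteq V=\mathrm{Mat}_n^m$. Let $\tau$ denote the linear transformation of $V$ that sends $X=(X_1,\dots,X_m)\mapsto(X_1^t,\dots,X_m^t)$. Then the group of symmetries of $S$ is $$\mathcal{G}_S=G_{n,m}\cup G_{n,m}\cdot\tau=G_{n,m}\rtimes\mathbb{Z}/2 .$$
   Context: The ground field is $\mathbb{C}$. $\mathrm{Mat}_n^m$ is the space of $m$-tuples of $n\times n$ complex matrices, $X^t$ denotes the transpose of a matrix $X$, and $\mathrm{SING}_{n,m}=\{(X_1,\dots,X_m)\in\mathrm{Mat}_n^m : \sum_{i=1}^m t_iX_i \text{ is singular over } \mathbb{C}(t_1,\dots,t_m)\}$, where $t_1,\dots,t_m$ are (commuting) indeterminates. For a subvariety $S$ of a vector space $V$, its group of symmetries is $\mathcal{G}_S=\{g\in\mathrm{GL}(V) : gS=S\}$. The group $\mathrm{GL}_m\times\mathrm{GL}_n\times\mathrm{GL}_n$ acts linearly on $\mathrm{Mat}_n^m$ by $$(P,Q,R)\cdot(X_1,\dots,X_m)=\Big(\sum_{j=1}^m p_{1j}QX_jR^{-1},\ \sum_{j=1}^m p_{2j}QX_jR^{-1},\ \dots,\ \sum_{j=1}^m p_{mj}QX_jR^{-1}\Big),$$ where $p_{ij}$ is the $(i,j)$ entry of $P$. $G_{n,m}$ denotes the image of the resulting homomorphism $\mathrm{GL}_m\times\mathrm{GL}_n\times\mathrm{GL}_n\to\mathrm{GL}(\mathrm{Mat}_n^m)$. The factor $\mathbb{Z}/2$ is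 the group generated by $\tau$.
   Formalization: For n = 1, τ is the identity, so the group it generates is trivial and not Z/2; that this group is Z/2 is claimed only for n ≥ 2, while both equalities, with Z/2 read as the group generated by τ, are proved for all n, m ≥ 1. *)

theory Defs
  imports
    "HOL-Analysis.Analysis"
    "HOL-Algebra.Elementary_Groups"
    "HOL-Computational_Algebra.Fraction_Field"
    "HOL-Library.Poly_Mapping"
begin

text \<open>
  The tuple \<open>(X\<^sub>1, \<dots>, X\<^sub>m)\<close> of complex \<open>n \<times> n\<close> matrices has components \<open>X $ i\<close>, with
  \<open>m = CARD('m)\<close> and \<open>n = CARD('n)\<close>.
\<close>

type_synonym ('n, 'm) mats = "complex ^ 'n ^ 'n ^ 'm"

text \<open>
  Scaling by a complex number; the library's \<open>(*s)\<close> on iterated vector types would need a scalar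
  that is itself a matrix.
\<close>

definition mat_scale :: "'a::times \<Rightarrow> 'a ^ 'k ^ 'l \<Rightarrow> 'a ^ 'k ^ 'l" where
  "mat_scale c A = (\<chi> i. c *s (A $ i))"

definition mats_scale :: "complex \<Rightarrow> ('n::finite, 'm::finite) mats \<Rightarrow> ('n, 'm) mats" where
  "mats_scale c X = (\<chi> i. mat_scale c (X $ i))"

lemma vector_space_mats_scale: "vector_space mats_scale"
  by unfold_locales
    (auto simp: mats_scale_def mat_scale_def vec_eq_iff algebra_simps)


text \<open>
  The field \<open>\<complex>(t\<^sub>1, \<dots>, t\<^sub>m)\<close> is the fraction field of \<open>('m \<Rightarrow>\<^sub>0 nat) \<Rightarrow>\<^sub>0 complex\<close>, the
  polynomial ring in commuting indeterminates indexed by \<open>'m\<close>: a monomial is an exponent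
  function \<open>'m \<Rightarrow>\<^sub>0 nat\<close>. The order on \<open>'m\<close> only serves to make the library's integral domain
  instance for this ring applicable.
\<close>

type_synonym 'm ratfun = "(('m \<Rightarrow>\<^sub>0 nat) \<Rightarrow>\<^sub>0 complex) fract"

definition ratfun_const :: "complex \<Rightarrow> 'm::linorder ratfun" where
  "ratfun_const c = Fract (Poly_Mapping.single 0 c) 1"

definition ratfun_var :: "'m::linorder \<Rightarrow> 'm ratfun" where
  "ratfun_var i = Fract (Poly_Mapping.single (Poly_Mapping.single i 1) 1) 1"

definition generic_comb ::
    "('n::finite, 'm::{finite,linorder}) mats \<Rightarrow> 'm ratfun ^ 'n ^ 'n" where
  "generic_comb X =
     (\<Sum>i\<in>UNIV. mat_scale (ratfun_var i) (map_matrix ratfun_const (X $ i)))"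

definition SING :: "('n::finite, 'm::{finite,linorder}) mats set" where
  "SING = {X. \<not> invertible (generic_comb X)}"


definition GL_mats :: "(('n::finite, 'm::finite) mats \<Rightarrow> ('n, 'm) mats) monoid" where
  "GL_mats =
     \<lparr>carrier = {g. Vector_Spaces.linear mats_scale mats_scale g \<and> bij g},
      mult = (\<circ>), one = id\<rparr>"

lemma linear_mats_iff:
  "Vector_Spaces.linear mats_scale mats_scale g \<longleftrightarrow>
     (\<forall>x y. g (x + y) = g x + g y) \<and> (\<forall>c x. g (mats_scale c x) = mats_scale c (g x))"
  unfolding module_hom_iff_linear[symmetric] module_hom_def module_hom_axioms_def
    module_iff_vector_space
  by (simp add: vector_space_mats_scale)

lemma group_GL_mats: "group (GL_mats :: (('n::finite, 'm::finite) mats \<Rightarrow> ('n, 'm) mats) monoid)"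
proof (rule groupI)
  fix g :: "('n, 'm) mats \<Rightarrow> ('n, 'm) mats"
  assume "g \<in> carrier GL_mats"
  then have add: "\<And>x y. g (x + y) = g x + g y"
    and scale: "\<And>c x. g (mats_scale c x) = mats_scale c (g x)" and bij: "bij g"
    by (auto simp: GL_mats_def linear_mats_iff)
  have "inv_into UNIV g (x + y) = inv_into UNIV g x + inv_into UNIV g y" for x y
    by (metis add bij bij_inv_eq_iff)
  moreover have "inv_into UNIV g (mats_scale c x) = mats_scale c (inv_into UNIV g x)" for c x
    by (metis scale bij bij_inv_eq_iff)
  moreover have "inv_into UNIV g \<circ> g = id"
    using bij by (simp add: bij_is_inj)
  ultimately show "\<exists>h\<in>carrier GL_mats. h \<otimes>\<^bsub>GL_mats\<^esub> g = \<one>\<^bsub>GL_mats\<^esub>"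
    using bij bij_imp_bij_inv
    by (auto simp: GL_mats_def linear_mats_iff intro!: exI[of _ "inv_into UNIV g"])
qed (auto simp: GL_mats_def linear_mats_iff o_assoc intro: bij_comp)

definition symmetries ::
    "('n::finite, 'm::finite) mats set \<Rightarrow> (('n, 'm) mats \<Rightarrow> ('n, 'm) mats) set" where
  "symmetries S = {g \<in> carrier GL_mats. g ` S = S}"

definition act ::
    "complex ^ 'm ^ 'm \<Rightarrow> complex ^ 'n ^ 'n \<Rightarrow> complex ^ 'n ^ 'n
      \<Rightarrow> ('n::finite, 'm::finite) mats \<Rightarrow> ('n, 'm) mats" where
  "act P Q R X = (\<chi> i. \<Sum>j\<in>UNIV. mat_scale (P $ i $ j) (Q ** X $ j ** matrix_inv R))"

definition G_nm :: "(('n::finite, 'm::finite) mats \<Rightarrow> ('n, 'm) mats) set" where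
  "G_nm = {act P Q R | P Q R. invertible P \<and> invertible Q \<and> invertible R}"

definition \<tau> :: "('n::finite, 'm::finite) mats \<Rightarrow> ('n, 'm) mats" where
  "\<tau> X = (\<chi> i. transpose (X $ i))"


definition internal_semidirect_product ::
    "('a, 'b) monoid_scheme \<Rightarrow> 'a set \<Rightarrow> 'a set \<Rightarrow> bool" where
  "internal_semidirect_product K N H \<longleftrightarrow>
     N \<lhd> K \<and> subgroup H K \<and> N \<inter> H = {\<one>\<^bsub>K\<^esub>} \<and> N <#>\<^bsub>K\<^esub> H = carrier K"

end

theory Submission
  imports Defs
begin

text \<open>
  A tuple \<open>X\<close> is singular iff all specializations \<open>\<Sum>\<^sub>k t\<^sub>k X\<^sub>k\<close> with \<open>t \<in> \<complex>\<^sup>m\<close> are singular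
  matrices. The tuples whose specializations all have rank at most one are exactly the directions
  \<open>X\<close> such that every line \<open>Y + s X\<close> meeting the singular set at \<open>s = 0\<close> and \<open>s = 1\<close> lies in it;
  hence a symmetry \<open>g\<close> preserves this rank-one set. View tuples as tensors in
  \<open>\<complex>\<^sup>m \<otimes> \<complex>\<^sup>n \<otimes> \<complex>\<^sup>n\<close>. The linear subspaces of dimension \<open>m n\<close> of the rank-one set
  are the spaces \<open>\<complex>\<^sup>m \<otimes> \<complex>\<^sup>n \<otimes> v\<close> and \<open>\<complex>\<^sup>m \<otimes> u \<otimes> \<complex>\<^sup>n\<close>, so \<open>g\<close> permutes them.
  Spaces of the same kind meet trivially while those of different kinds do not, so after composing
  with the transposition \<open>\<tau>\<close> if necessary \<open>g\<close> respects both kinds. Then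
  \<open>g (x \<otimes> u \<otimes> v)\<close> is again a pure tensor whose last two factors depend only on \<open>u\<close> and
  \<open>v\<close> up to scalars, which forces \<open>g\<close> to be a tensor product of three linear maps.
\<close>

section \<open>Singularity of a pencil at all specializations\<close>

text \<open>The generic combination of \<open>X\<close> specialized at a point \<open>t\<close> of
  C^m; it turns questions over the function field into questions about complex matrices.\<close>

definition pencil :: "('n::finite, 'm::finite) mats \<Rightarrow> complex ^ 'm \<Rightarrow> complex ^ 'n ^ 'n" where
  "pencil X t = (\<chi> a b. \<Sum>k\<in>UNIV. t $ k * X $ k $ a $ b)"

lemma pencil_nth: "pencil X t $ a $ b = (\<Sum>k\<in>UNIV. t $ k * X $ k $ a $ b)"
  by (simp add: pencil_def)

text \<open>The Leibniz formula uses only sums, products and signs. The lemma serves both for the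
  embedding of polynomials into the fraction field and for evaluation at a point.\<close>

lemma det_ring_hom:
  fixes h :: "'a::comm_ring_1 \<Rightarrow> 'b::comm_ring_1" and A :: "'a ^ 'n ^ 'n"
  assumes one: "h 1 = 1" and add: "\<And>x y. h (x + y) = h x + h y"
    and mult: "\<And>x y. h (x * y) = h x * h y"
  shows "h (det A) = det (map_matrix h A)"
proof -
  have zero: "h 0 = 0"
    using add[of 0 0] by simp
  have uminus: "h (- x) = - h x" for x
    using add[of x "- x"] zero by (simp add: eq_neg_iff_add_eq_0 add.commute)
  have sign: "h (of_int (sign p)) = of_int (sign p)" for p :: "'n \<Rightarrow> 'n"
    by (simp add: sign_def one uminus)
  have sum: "h (sum f S) = (\<Sum>x\<in>S. h (f x))" if "finite S" for f :: "('n \<Rightarrow> 'n) \<Rightarrow> 'a" and S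
    using that by induction (auto simp: zero add)
  have prod: "h (prod f S) = (\<Prod>x\<in>S. h (f x))" if "finite S" for f :: "'n \<Rightarrow> 'a" and S
    using that by induction (auto simp: one mult)
  show ?thesis
    unfolding det_def by (simp add: sum mult sign prod)
qed

section \<open>Evaluation of polynomials at points of C^m\<close>

definition monom_eval :: "complex ^ 'm \<Rightarrow> ('m::finite \<Rightarrow>\<^sub>0 nat) \<Rightarrow> complex" where
  "monom_eval t e = (\<Prod>i\<in>UNIV. t $ i ^ Poly_Mapping.lookup e i)"

definition poly_eval :: "complex ^ 'm \<Rightarrow> (('m::finite \<Rightarrow>\<^sub>0 nat) \<Rightarrow>\<^sub>0 complex) \<Rightarrow> complex" where
  "poly_eval t p = (\<Sum>e\<in>Poly_Mapping.keys p. Poly_Mapping.lookup p e * monom_eval t e)"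

lemma poly_eval_add: "poly_eval t (p + q) = poly_eval t p + poly_eval t q"
  unfolding poly_eval_def
  by (rule Poly_Mapping.setsum_keys_plus_distrib) (auto simp: algebra_simps)

lemma poly_eval_single: "poly_eval t (Poly_Mapping.single e c) = c * monom_eval t e"
  by (simp add: poly_eval_def)

lemma poly_eval_sum: "finite S \<Longrightarrow> poly_eval t (sum f S) = (\<Sum>x\<in>S. poly_eval t (f x))"
  by (induction S rule: finite_induct) (auto simp: poly_eval_add, simp add: poly_eval_def)

lemma monom_eval_add: "monom_eval t (d + e) = monom_eval t d * monom_eval t e"
  by (simp add: monom_eval_def lookup_add power_add prod.distrib)

lemma poly_mapping_sum_single:
  "p = (\<Sum>e\<in>Poly_Mapping.keys p. Poly_Mapping.single e (Poly_Mapping.lookup p e))"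
proof (rule poly_mapping_eqI)
  fix k
  show "Poly_Mapping.lookup p k = Poly_Mapping.lookup (\<Sum>e\<in>Poly_Mapping.keys p.
      Poly_Mapping.single e (Poly_Mapping.lookup p e)) k"
    by (auto simp: lookup_sum lookup_single when_def in_keys_iff)
qed

text \<open>Expanding both factors into monomials reduces multiplicativity to
  \<open>monom_eval_add\<close>.\<close>

lemma poly_eval_mult: "poly_eval t (p * q) = poly_eval t p * poly_eval t q"
proof -
  have "p * q = (\<Sum>d\<in>Poly_Mapping.keys p. \<Sum>e\<in>Poly_Mapping.keys q.
      Poly_Mapping.single (d + e) (Poly_Mapping.lookup p d * Poly_Mapping.lookup q e))"
    by (subst poly_mapping_sum_single[of p], subst poly_mapping_sum_single[of q])
      (simp add: sum_product mult_single)
  then show ?thesis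
    by (simp add: poly_eval_sum poly_eval_single monom_eval_add)
      (simp add: poly_eval_def sum_product mult_ac)
qed

lemma poly_eval_one: "poly_eval t 1 = 1"
  by (simp add: poly_eval_def monom_eval_def)

lemma monom_eval_times: "monom_eval (s * t) e = monom_eval s e * monom_eval t e"
  by (simp add: monom_eval_def power_mult_distrib prod.distrib)

text \<open>At the point with coordinate 2 at an index where the exponents differ and 1 elsewhere,
  the two monomials are different powers of 2.\<close>

lemma monom_eval_separates:
  assumes "d \<noteq> e"
  obtains t where "monom_eval t d \<noteq> monom_eval t e"
proof -
  obtain i where i: "Poly_Mapping.lookup d i \<noteq> Poly_Mapping.lookup e i"
    using assms by (meson poly_mapping_eqI)
  have "monom_eval (\<chi> j. if j = i then 2 else 1) c = 2 ^ Poly_Mapping.lookup c i" for c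
    by (simp add: monom_eval_def if_distrib[of "\<lambda>x. x ^ _"] cong: if_cong)
  moreover have "(2::complex) ^ Poly_Mapping.lookup d i \<noteq> 2 ^ Poly_Mapping.lookup e i"
    using i by (metis numeral_power_eq_of_nat_cancel_iff of_nat_numeral of_nat_power_eq_of_nat_cancel_iff
        power_inject_exp one_less_numeral_iff semiring_norm(76))
  ultimately show thesis
    by (metis that)
qed

text \<open>Dedekind's argument for the independence of characters, here of the monoid of points.\<close>

lemma monom_eval_independent:
  assumes "finite E" and "\<And>t. (\<Sum>e\<in>E. c e * monom_eval t e) = 0" and "e \<in> E"
  shows "c e = 0"
  using assms
proof (induction "card E" arbitrary: E c e rule: less_induct)
  case less
  have *: "c d = 0" if d: "d \<in> E" "d \<noteq> e" for d
  proof -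
    obtain s where s: "monom_eval s d \<noteq> monom_eval s e"
      using monom_eval_separates[OF d(2)] .
    \<comment> \<open>Subtracting \<open>monom_eval s e\<close> times the relation at
      \<open>t\<close> from the relation at \<open>s * t\<close> cancels the term of
      \<open>e\<close> and leaves a shorter relation.\<close>
    have "(\<Sum>f\<in>E - {e}. (c f * (monom_eval s f - monom_eval s e)) * monom_eval t f) = 0" for t
    proof -
      have "(\<Sum>f\<in>E. c f * (monom_eval s f - monom_eval s e) * monom_eval t f)
          = (\<Sum>f\<in>E. c f * monom_eval (s * t) f) - monom_eval s e * (\<Sum>f\<in>E. c f * monom_eval t f)"
        by (simp add: sum_distrib_left monom_eval_times algebra_simps sum_subtractf)
      also have "\<dots> = 0"
        by (simp add: less.prems(2))
      finally show ?thesis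
        using less.prems(1,3) by (simp add: sum.remove[of E e])
    qed
    moreover have "card (E - {e}) < card E"
      using less.prems by (meson card_Diff1_less)
    ultimately have "c d * (monom_eval s d - monom_eval s e) = 0"
      using less.hyps[of "E - {e}" "\<lambda>f. c f * (monom_eval s f - monom_eval s e)" d] less.prems d
      by auto
    then show ?thesis
      using s by simp
  qed
  \<comment> \<open>At the all-ones point every monomial equals 1, so only the coefficient of
    \<open>e\<close> survives.\<close>
  have "(\<Sum>f\<in>E. c f * monom_eval 1 f) = c e"
    using less.prems * by (simp add: sum.remove[of E e] monom_eval_def)
  then show ?case
    using less.prems(2) by metis
qed

lemma poly_eval_eq_0_iff: "(\<forall>t. poly_eval t p = 0) \<longleftrightarrow> p = 0"
proof
  assume "\<forall>t. poly_eval t p = 0"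
  then have "Poly_Mapping.lookup p e = 0" if "e \<in> Poly_Mapping.keys p" for e
    using monom_eval_independent[of "Poly_Mapping.keys p" "Poly_Mapping.lookup p" e] that
    by (simp add: poly_eval_def)
  then show "p = 0"
    by (metis in_keys_iff lookup_zero poly_mapping_eqI)
qed (simp add: poly_eval_def)

text \<open>The generic combination before passage to the fraction field: its entries are linear
  forms, which can be evaluated at points.\<close>

definition poly_comb ::
    "('n::finite, 'm::{finite,linorder}) mats \<Rightarrow> (('m \<Rightarrow>\<^sub>0 nat) \<Rightarrow>\<^sub>0 complex) ^ 'n ^ 'n" where
  "poly_comb X = (\<chi> a b. \<Sum>i\<in>UNIV. Poly_Mapping.single (Poly_Mapping.single i 1) (X $ i $ a $ b))"

lemma Fract_sum: "finite S \<Longrightarrow> Fract (sum f S) 1 = (\<Sum>x\<in>S. Fract (f x) 1)"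
proof (induction S rule: finite_induct)
  case (insert x F)
  have "Fract (f x) 1 + Fract (sum f F) 1 = Fract (f x + sum f F) 1"
    by simp
  then show ?case
    using insert by simp
qed (simp add: Zero_fract_def)

lemma generic_comb_eq: "generic_comb X = map_matrix (\<lambda>p. Fract p 1) (poly_comb X)"
  by (simp add: generic_comb_def poly_comb_def vec_eq_iff mat_scale_def ratfun_var_def
      ratfun_const_def mult_single Fract_sum)

lemma map_matrix_poly_eval: "map_matrix (poly_eval t) (poly_comb X) = pencil X t"
proof -
  have "monom_eval t (Poly_Mapping.single i 1) = t $ i" for i
    by (simp add: monom_eval_def lookup_single when_def if_distrib[of "\<lambda>x. _ ^ x"] cong: if_cong)
  then show ?thesis
    by (simp add: poly_comb_def pencil_def vec_eq_iff poly_eval_sum poly_eval_single mult.commute)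
qed

text \<open>The determinant commutes with the embedding and with evaluation, the embedding is
  injective, and a complex polynomial that vanishes at every point is zero.\<close>

lemma SING_iff: "X \<in> SING \<longleftrightarrow> (\<forall>t. det (pencil X t) = 0)"
proof -
  have "X \<in> SING \<longleftrightarrow> det (generic_comb X) = 0"
    by (simp add: SING_def invertible_det_nz)
  also have "det (generic_comb X) = Fract (det (poly_comb X)) 1"
    unfolding generic_comb_eq by (rule det_ring_hom[symmetric]) (auto simp: One_fract_def)
  also have "\<dots> = 0 \<longleftrightarrow> det (poly_comb X) = 0"
    by (simp add: Zero_fract_def eq_fract)
  also have "\<dots> \<longleftrightarrow> (\<forall>t. poly_eval t (det (poly_comb X)) = 0)"
    by (simp only: poly_eval_eq_0_iff)
  also have "\<dots> \<longleftrightarrow> (\<forall>t. det (pencil X t) = 0)"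
    by (simp add: det_ring_hom[of "poly_eval _"] poly_eval_one poly_eval_add poly_eval_mult
        map_matrix_poly_eval)
  finally show ?thesis .
qed


section \<open>Pencils of rank at most one\<close>

definition outer :: "complex ^ 'k \<Rightarrow> complex ^ 'l \<Rightarrow> complex ^ 'l ^ 'k" where
  "outer u v = (\<chi> a b. u $ a * v $ b)"

lemma outer_nth [simp]: "outer u v $ a $ b = u $ a * v $ b"
  by (simp add: outer_def)

text \<open>Vanishing of all 2x2 minors, a form that requires no choice of factors.\<close>

definition rank_le_1 :: "complex ^ 'l ^ 'k \<Rightarrow> bool" where
  "rank_le_1 M \<longleftrightarrow> (\<forall>a b c d. M $ a $ b * M $ c $ d = M $ a $ d * M $ c $ b)"

text \<open>If the entry at \<open>(a, b)\<close> is nonzero, column \<open>b\<close> and the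
  rescaled row \<open>a\<close> are the two factors.\<close>

lemma rank_le_1_iff:
  fixes M :: "complex ^ 'l ^ 'k"
  shows "rank_le_1 M \<longleftrightarrow> (\<exists>u v. M = outer u v)"
proof
  assume M: "rank_le_1 M"
  show "\<exists>u v. M = outer u v"
  proof (cases "M = 0")
    case True
    have "outer 0 0 = (0 :: complex ^ 'l ^ 'k)"
      by (simp add: outer_def vec_eq_iff)
    with True show ?thesis by metis
  next
    case False
    then obtain a b where ab: "M $ a $ b \<noteq> 0"
      by (auto simp: vec_eq_iff)
    have entry: "M $ c $ d = M $ c $ b * (M $ a $ d / M $ a $ b)" for c d
      using M ab unfolding rank_le_1_def by (simp add: field_simps)
    have "M = outer (\<chi> c. M $ c $ b) (\<chi> d. M $ a $ d / M $ a $ b)"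
      unfolding vec_eq_iff using entry by (metis outer_nth vec_lambda_beta)
    then show ?thesis by blast
  qed
qed (auto simp: rank_le_1_def)

text \<open>Along a line of rank-one direction the determinant is a polynomial of degree at most one
  in \<open>s\<close>; two zeros, at 0 and 1, make it vanish identically.\<close>

lemma det_add_outer_eq_0:
  fixes Y :: "complex ^ 'n ^ 'n"
  assumes "det Y = 0" "det (Y + outer u v) = 0"
  shows "det (Y + mat_scale s (outer u v)) = 0"
proof (cases "u = 0")
  case True
  then have "Y + mat_scale s (outer u v) = Y"
    by (simp add: vec_eq_iff mat_scale_def)
  then show ?thesis using assms by simp
next
  case False
  then obtain i where i: "u $ i \<noteq> 0"
    by (auto simp: vec_eq_iff)
  \<comment> \<open>Row operations clear \<open>s\<close> from every row but the \<open>i\<close>-th, so the determinant is affine in \<open>s\<close>.\<close>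
  define r where "r a = (if a = i then 0 else u $ a / u $ i)" for a
  define L :: "complex ^ 'n ^ 'n" where
    "L = (\<chi> a b. (if a = b then 1 else 0) - (if b = i then r a else 0))"
  have L_mult: "(\<Sum>k\<in>UNIV. L $ a $ k * f k) = f a - r a * f i" for a and f :: "'n \<Rightarrow> complex"
    by (simp add: L_def left_diff_distrib sum_subtractf if_distrib[of "\<lambda>x. x * _"] cong: if_cong)
  have "x = 0" if "L *v x = 0" for x
  proof -
    have x: "x $ a = r a * x $ i" for a
      using that L_mult[of a "\<lambda>k. x $ k"] by (auto simp: vec_eq_iff matrix_vector_mult_def)
    from x[of i] have "x $ i = 0" by (simp add: r_def)
    with x show "x = 0" by (simp add: vec_eq_iff)
  qed
  then have L: "det L \<noteq> 0"
    using invertible_left_inverse matrix_left_invertible_ker invertible_det_nz by blast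
  define b where "b a = Y $ a - r a *s Y $ i" for a
  have LM: "L ** (Y + mat_scale s (outer u v))
      = (\<chi> a. if a = i then b a + s *s (u $ i *s v) else b a)" for s
  proof -
    have entry: "(L ** (Y + mat_scale s (outer u v))) $ a $ j
        = (Y $ a $ j + s * (u $ a * v $ j)) - r a * (Y $ i $ j + s * (u $ i * v $ j))" for a j
      unfolding matrix_matrix_mult_def
      using L_mult[of a "\<lambda>k. Y $ k $ j + s * (u $ k * v $ j)"] by (simp add: mat_scale_def)
    then show ?thesis
      using i by (simp add: vec_eq_iff entry b_def r_def algebra_simps)
  qed
  have affine: "det L * det (Y + mat_scale s (outer u v)) = det (\<chi> a. if a = i then b a else b a)
      + s * det (\<chi> a. if a = i then u $ i *s v else b a)" for s
    using det_row_add[of i "\<lambda>a. b a" "\<lambda>_. s *s (u $ i *s v)" b]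
      det_row_mul[of i s "\<lambda>_. u $ i *s v" b]
    unfolding det_mul[symmetric] LM by simp
  have "Y + mat_scale 0 (outer u v) = Y" "Y + mat_scale 1 (outer u v) = Y + outer u v"
    by (simp_all add: vec_eq_iff mat_scale_def)
  then have "det L * det (Y + mat_scale s (outer u v)) = 0"
    using assms affine[of 0] affine[of 1] affine[of s] by simp
  then show ?thesis
    using L by simp
qed

lemma pencil_add: "pencil (X + Y) t = pencil X t + pencil Y t"
  by (simp add: vec_eq_iff pencil_nth sum.distrib algebra_simps)

lemma pencil_scale: "pencil (mats_scale s X) t = mat_scale s (pencil X t)"
  by (simp add: vec_eq_iff pencil_nth mats_scale_def mat_scale_def sum_distrib_left mult_ac)

text \<open>The tuples whose components span a linear space of matrices of rank at most one.\<close>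

definition RANK1 :: "('n::finite, 'm::finite) mats set" where
  "RANK1 = {X. \<forall>t. rank_le_1 (pencil X t)}"

lemma SING_line_of_RANK1:
  assumes "X \<in> RANK1" "Y \<in> SING" "Y + X \<in> SING"
  shows "Y + mats_scale s X \<in> SING"
  unfolding SING_iff
proof
  fix t
  obtain u v where uv: "pencil X t = outer u v"
    using assms(1) unfolding RANK1_def rank_le_1_iff by blast
  have "det (pencil Y t) = 0" "det (pencil Y t + outer u v) = 0"
    using assms(2,3) by (auto simp: SING_iff pencil_add simp flip: uv)
  then show "det (pencil (Y + mats_scale s X) t) = 0"
    unfolding pencil_add pencil_scale uv by (rule det_add_outer_eq_0)
qed

text \<open>\<open>Y\<close> is chosen so that one column of Y + s X has the factor s - 1 and
  another the factor s. At s = 2 a nonzero 2x2 minor of a specialization of \<open>X\<close> is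
  completed to an invertible matrix.\<close>

lemma SING_line_escapes:
  fixes X :: "('n::finite, 'm::{finite,linorder}) mats"
  assumes "X \<notin> RANK1"
  obtains Y where "Y \<in> SING" "Y + X \<in> SING" "Y + mats_scale 2 X \<notin> SING"
proof -
  obtain t where "\<not> rank_le_1 (pencil X t)"
    using assms by (auto simp: RANK1_def)
  define M where "M = pencil X t"
  obtain a b c d where minor: "M $ a $ b * M $ c $ d \<noteq> M $ a $ d * M $ c $ b"
    using \<open>\<not> rank_le_1 (pencil X t)\<close> unfolding rank_le_1_def M_def by blast
  have "a \<noteq> c" "b \<noteq> d"
    using minor by (auto simp: mult.commute)
  have "\<exists>k. t $ k \<noteq> 0"
  proof (rule ccontr)
    assume "\<nexists>k. t $ k \<noteq> 0"
    then show False
      using minor by (simp add: M_def pencil_nth)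
  qed
  then obtain k where k: "t $ k \<noteq> 0" by blast
  have "card (UNIV - {b, d}) = card (UNIV - {a, c})"
    using \<open>a \<noteq> c\<close> \<open>b \<noteq> d\<close> by (simp add: card_Diff_subset)
  \<comment> \<open>\<open>\<pi>\<close> assigns to each remaining column the row in which its unit
    vector has its one.\<close>
  then obtain \<pi> where \<pi>: "bij_betw \<pi> (UNIV - {b, d}) (UNIV - {a, c})"
    by (meson finite finite_same_card_bij)
  \<comment> \<open>Column \<open>b\<close> of \<open>Y + s X\<close> vanishes at \<open>s = 1\<close> and column \<open>d\<close> at \<open>s = 0\<close>. At \<open>s = 2\<close> and \<open>t\<close> they are
    the columns \<open>b\<close> and \<open>d\<close> of \<open>M\<close> up to scalars, and the other columns are the unit vectors
    outside rows \<open>a\<close>, \<open>c\<close>.\<close>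
  define Y :: "('n, 'm) mats" where
    "Y = (\<chi> l r j. if j = b then - X $ l $ r $ b else if j = d then 0
       else if l = k then ((if r = \<pi> j then 1 else 0) - 2 * M $ r $ j) / t $ k else 0)"
  have "column d (pencil Y s) = 0" for s
    using \<open>b \<noteq> d\<close> by (simp add: vec_eq_iff column_def pencil_nth Y_def)
  then have 1: "Y \<in> SING"
    unfolding SING_iff using det_zero_column(2) by blast
  have "column b (pencil (Y + X) s) = 0" for s
    by (simp add: vec_eq_iff column_def pencil_nth Y_def)
  then have 2: "Y + X \<in> SING"
    unfolding SING_iff using det_zero_column(2) by blast
  define N where "N = pencil (Y + mats_scale 2 X) t"
  \<comment> \<open>Outside columns \<open>b\<close> and \<open>d\<close> only component
    \<open>k\<close> is nonzero, and division by \<open>t $ k\<close> gives the specialization at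
    \<open>t\<close> exactly the prescribed entries.\<close>
  have Y_t: "pencil Y t $ r $ j = (if j = b then - M $ r $ b else if j = d then 0
      else (if r = \<pi> j then 1 else 0) - 2 * M $ r $ j)" for r j
    using k by (simp add: pencil_nth Y_def M_def sum_negf if_distrib[of "\<lambda>x. _ * x"] cong: if_cong)
  have N: "N $ r $ j = (if j = b then M $ r $ b else if j = d then 2 * M $ r $ d
      else if r = \<pi> j then 1 else 0)" for r j
    by (simp add: N_def pencil_add pencil_scale Y_t) (simp add: mat_scale_def M_def)
  have "x = 0" if "N *v x = 0" for x
  proof -
    have row: "M $ r $ b * x $ b + 2 * M $ r $ d * x $ d
        + (\<Sum>j\<in>UNIV - {b, d}. if r = \<pi> j then x $ j else 0) = 0" for r
    proof -
      have "0 = (\<Sum>j\<in>UNIV. N $ r $ j * x $ j)"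
        using that by (simp add: vec_eq_iff matrix_vector_mult_def)
      also have "\<dots> = N $ r $ b * x $ b + (N $ r $ d * x $ d
          + (\<Sum>j\<in>UNIV - {b} - {d}. N $ r $ j * x $ j))"
        using \<open>b \<noteq> d\<close> by (simp add: sum.remove[of _ b] sum.remove[of _ d])
      also have "UNIV - {b} - {d} = UNIV - {b, d}" by blast
      also have "(\<Sum>j\<in>UNIV - {b, d}. N $ r $ j * x $ j)
          = (\<Sum>j\<in>UNIV - {b, d}. if r = \<pi> j then x $ j else 0)"
        by (rule sum.cong) (auto simp: N)
      finally show ?thesis
        using \<open>b \<noteq> d\<close> by (simp add: N add.assoc)
    qed
    have \<pi>_ne: "\<pi> j \<noteq> a" "\<pi> j \<noteq> c" if "j \<in> UNIV - {b, d}" for j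
      using bij_betwE[OF \<pi>] that by blast+
    have zero: "(\<Sum>j\<in>UNIV - {b, d}. if r = \<pi> j then x $ j else 0) = 0" if "r = a \<or> r = c" for r
      using that \<pi>_ne by (intro sum.neutral) auto
    then have eq: "M $ a $ b * x $ b + 2 * M $ a $ d * x $ d = 0"
      "M $ c $ b * x $ b + 2 * M $ c $ d * x $ d = 0"
      using row[of a] row[of c] by (simp_all add: zero)
    \<comment> \<open>Rows \<open>a\<close> and \<open>c\<close> form a 2x2 system in
      \<open>x $ b\<close> and \<open>x $ d\<close>; this is Cramer's rule for it.\<close>
    have "(M $ a $ b * M $ c $ d - M $ a $ d * M $ c $ b) * x $ b = 0"
      "(M $ a $ b * M $ c $ d - M $ a $ d * M $ c $ b) * (2 * x $ d) = 0"
      using eq by algebra+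
    then have bd: "x $ b = 0" "x $ d = 0"
      using minor by auto
    \<comment> \<open>With these two coordinates zero, row \<open>\<pi> j\<close> reads off
      \<open>x $ j\<close>.\<close>
    have "x $ j = 0" if j: "j \<in> UNIV - {b, d}" for j
    proof -
      have "\<pi> j = \<pi> i \<longleftrightarrow> j = i" if "i \<in> UNIV - {b, d}" for i
        using \<pi> j that by (metis bij_betw_imp_inj_on inj_onD)
      then have "(\<Sum>i\<in>UNIV - {b, d}. if \<pi> j = \<pi> i then x $ i else 0)
          = (\<Sum>i\<in>UNIV - {b, d}. if j = i then x $ i else 0)"
        by (intro sum.cong) auto
      then show ?thesis
        using row[of "\<pi> j"] bd j by simp
    qed
    with bd show ?thesis
      by (metis DiffI UNIV_I insertE singletonD vec_eq_iff zero_index)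
  qed
  then have "det N \<noteq> 0"
    using invertible_left_inverse matrix_left_invertible_ker invertible_det_nz by blast
  then have "Y + mats_scale 2 X \<notin> SING"
    by (auto simp: SING_iff N_def)
  with 1 2 that show thesis by blast
qed

text \<open>Describes the rank-one set through \<open>SING\<close> and the linear structure alone,
  so that every symmetry of \<open>SING\<close> respects it.\<close>

lemma RANK1_iff_SING:
  "X \<in> RANK1 \<longleftrightarrow> (\<forall>Y. Y \<in> SING \<and> Y + X \<in> SING \<longrightarrow> (\<forall>s. Y + mats_scale s X \<in> SING))"
proof
  assume X: "\<forall>Y. Y \<in> SING \<and> Y + X \<in> SING \<longrightarrow> (\<forall>s. Y + mats_scale s X \<in> SING)"
  show "X \<in> RANK1"
  proof (rule ccontr)
    assume "X \<notin> RANK1"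
    then obtain Y where "Y \<in> SING" "Y + X \<in> SING" "Y + mats_scale 2 X \<notin> SING"
      by (rule SING_line_escapes)
    with X show False by blast
  qed
qed (simp add: SING_line_of_RANK1)

lemma symmetry_SING_RANK1_iff:
  assumes "g \<in> symmetries SING"
  shows "g X \<in> RANK1 \<longleftrightarrow> X \<in> RANK1"
proof -
  have bij: "bij g" and im: "g ` SING = SING" and add: "\<And>x y. g (x + y) = g x + g y"
    and scale: "\<And>c x. g (mats_scale c x) = mats_scale c (g x)"
    using assms by (auto simp: symmetries_def GL_mats_def linear_mats_iff)
  have SING: "g Y \<in> SING \<longleftrightarrow> Y \<in> SING" for Y
    using bij im by (metis bij_is_inj inj_image_mem_iff)
  \<comment> \<open>Since \<open>g\<close> is surjective, the quantified tuple may be taken to be an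
    image \<open>g Y\<close>.\<close>
  have all: "(\<forall>Y. P Y) \<longleftrightarrow> (\<forall>Y. P (g Y))" for P
    using bij by (metis bij_pointE)
  show ?thesis
    unfolding RANK1_iff_SING by (subst all) (simp add: SING flip: add scale)
qed


section \<open>Large linear spaces of pencils of rank at most one\<close>

text \<open>The tensors with fixed last factor \<open>v\<close>, a copy of C^m \<otimes> C^n when
  \<open>v \<noteq> 0\<close>.\<close>

definition right_space :: "complex ^ 'n \<Rightarrow> ('n::finite, 'm::finite) mats set" where
  "right_space v = range (\<lambda>y. \<chi> k. outer (y $ k) v)"

definition left_space :: "complex ^ 'n \<Rightarrow> ('n::finite, 'm::finite) mats set" where
  "left_space u = range (\<lambda>y. \<chi> k. outer u (y $ k))"

lemma right_space_I: "(\<And>k. X $ k = outer (y k) v) \<Longrightarrow> X \<in> right_space v"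
  unfolding right_space_def by (rule range_eqI[of _ _ "\<chi> k. y k"]) (simp add: vec_eq_iff)

lemma left_space_I: "(\<And>k. X $ k = outer u (y k)) \<Longrightarrow> X \<in> left_space u"
  unfolding left_space_def by (rule range_eqI[of _ _ "\<chi> k. y k"]) (simp add: vec_eq_iff)

lemma right_space_E:
  assumes "X \<in> right_space v"
  obtains y where "\<And>k. X $ k = outer (y k) v"
  using assms unfolding right_space_def by auto

lemma left_space_E:
  assumes "X \<in> left_space u"
  obtains y where "\<And>k. X $ k = outer u (y k)"
  using assms unfolding left_space_def by auto

lemma RANK1_D: "X \<in> RANK1 \<Longrightarrow> rank_le_1 (pencil X t)"
  by (simp add: RANK1_def)

lemma pencil_axis: "pencil X (axis k 1) = X $ k"
  by (simp add: vec_eq_iff pencil_nth axis_def if_distrib[of "\<lambda>x. x * _"] cong: if_cong)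

lemma pencil_add_arg: "pencil X (s + t) = pencil X s + pencil X t"
  by (simp add: vec_eq_iff pencil_nth distrib_right sum.distrib)

lemma right_space_RANK1: "right_space v \<subseteq> RANK1"
proof
  fix X assume "X \<in> right_space v"
  then obtain y where y: "\<And>k. X $ k = outer (y k) v"
    using right_space_E by blast
  have "pencil X t = outer (\<chi> a. \<Sum>k\<in>UNIV. t $ k * y k $ a) v" for t
    by (simp add: vec_eq_iff pencil_nth y sum_distrib_right mult.assoc)
  then show "X \<in> RANK1"
    unfolding RANK1_def rank_le_1_iff by blast
qed

lemma left_space_RANK1: "left_space u \<subseteq> RANK1"
proof
  fix X assume "X \<in> left_space u"
  then obtain y where y: "\<And>k. X $ k = outer u (y k)"
    using left_space_E by blast
  have "pencil X t = outer u (\<chi> b. \<Sum>k\<in>UNIV. t $ k * y k $ b)" for t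
    by (simp add: vec_eq_iff pencil_nth y sum_distrib_left mult_ac)
  then show "X \<in> RANK1"
    unfolding RANK1_def rank_le_1_iff by blast
qed

text \<open>Each 2x2 minor of the sum is the product of a minor of the pair \<open>p\<close>,
  \<open>w\<close> and a minor of the pair \<open>z\<close>, \<open>q\<close>.\<close>

lemma rank_le_1_add_outer:
  assumes "rank_le_1 (outer p z + outer w q)"
  shows "p $ a * w $ c = p $ c * w $ a \<or> z $ b * q $ d = z $ d * q $ b"
proof -
  have "(p $ a * z $ b + w $ a * q $ b) * (p $ c * z $ d + w $ c * q $ d)
      = (p $ a * z $ d + w $ a * q $ d) * (p $ c * z $ b + w $ c * q $ b)"
    using assms unfolding rank_le_1_def by simp
  then have "(p $ a * w $ c - p $ c * w $ a) * (z $ b * q $ d - z $ d * q $ b) = 0"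
    by algebra
  then show ?thesis by simp
qed

lemma parallel_obtain:
  fixes z w :: "complex ^ 'n"
  assumes "z \<noteq> 0" "\<And>b d. z $ b * w $ d = z $ d * w $ b"
  obtains c where "w = c *s z"
proof -
  obtain b where b: "z $ b \<noteq> 0"
    using assms(1) by (auto simp: vec_eq_iff)
  have "w $ d = (w $ b / z $ b) * z $ d" for d
    using assms(2)[of b d] b by (simp add: field_simps)
  then have "w = (w $ b / z $ b) *s z"
    unfolding vec_eq_iff by (metis vector_smult_component)
  then show thesis by (rule that)
qed

text \<open>The classical description of spaces of rank-one matrices by a common factor. Every
  member is compared with one fixed nonzero member through their sum.\<close>

lemma rank_le_1_additive_set:
  fixes L :: "(complex ^ 'l ^ 'k) set"
  assumes rank: "\<And>M. M \<in> L \<Longrightarrow> rank_le_1 M"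
    and add: "\<And>M N. M \<in> L \<Longrightarrow> N \<in> L \<Longrightarrow> M + N \<in> L"
  shows "(\<exists>v. v \<noteq> 0 \<and> (\<forall>M\<in>L. \<exists>y. M = outer y v)) \<or> (\<exists>u. u \<noteq> 0 \<and> (\<forall>M\<in>L. \<exists>y. M = outer u y))"
proof (cases "L \<subseteq> {0}")
  case True
  have "(0 :: complex ^ 'l ^ 'k) = outer 0 1"
    by (simp add: vec_eq_iff)
  then have "\<forall>M\<in>L. \<exists>y. M = outer y 1"
    using True by blast
  moreover have "(1 :: complex ^ 'l) \<noteq> 0"
    by (simp add: vec_eq_iff)
  ultimately show ?thesis by blast
next
  case False
  then obtain M0 where M0: "M0 \<in> L" "M0 \<noteq> 0" by blast
  obtain u v where uv: "M0 = outer u v"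
    using rank[OF M0(1)] by (auto simp: rank_le_1_iff)
  have nz: "u \<noteq> 0" "v \<noteq> 0"
    using M0(2) by (auto simp: uv vec_eq_iff)
  have alt: "(\<exists>y. M = outer y v) \<or> (\<exists>y. M = outer u y)" if M: "M \<in> L" for M
  proof -
    obtain p q where pq: "M = outer p q"
      using rank[OF M] by (auto simp: rank_le_1_iff)
    have *: "u $ a * p $ c = u $ c * p $ a \<or> v $ b * q $ d = v $ d * q $ b" for a b c d
      using rank[OF add[OF M0(1) M]] unfolding uv pq by (rule rank_le_1_add_outer)
    show ?thesis
    proof (cases "\<forall>a c. u $ a * p $ c = u $ c * p $ a")
      case True
      then obtain e where "p = e *s u"
        using parallel_obtain[OF nz(1)] by metis
      then have "M = outer u (e *s q)"
        by (simp add: pq vec_eq_iff mult_ac)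
      then show ?thesis by blast
    next
      case False
      \<comment> \<open>One nonvanishing minor of \<open>u\<close> and \<open>p\<close> forces all
        minors of \<open>v\<close> and \<open>q\<close> to vanish.\<close>
      then have "v $ b * q $ d = v $ d * q $ b" for b d
        using * by blast
      then obtain e where "q = e *s v"
        using parallel_obtain[OF nz(2)] by metis
      then have "M = outer (e *s p) v"
        by (simp add: pq vec_eq_iff mult_ac)
      then show ?thesis by blast
    qed
  qed
  \<comment> \<open>An additive group is not the union of two proper subgroups.\<close>
  have "(\<forall>M\<in>L. \<exists>y. M = outer y v) \<or> (\<forall>M\<in>L. \<exists>y. M = outer u y)"
  proof (rule ccontr)
    assume "\<not> ?thesis"
    then obtain M N where M: "M \<in> L" "\<nexists>y. M = outer y v" and N: "N \<in> L" "\<nexists>y. N = outer u y"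
      by blast
    obtain q where q: "M = outer u q" using alt M by blast
    obtain p where p: "N = outer p v" using alt N by blast
    from alt[OF add[OF M(1) N(1)]] show False
    proof
      assume "\<exists>y. M + N = outer y v"
      then obtain y where "M + N = outer y v" by blast
      then have "M = outer y v - N" by (simp add: eq_diff_eq)
      also have "\<dots> = outer (y - p) v" unfolding p by (simp add: vec_eq_iff algebra_simps)
      finally show False using M(2) by blast
    next
      assume "\<exists>y. M + N = outer u y"
      then obtain y where "M + N = outer u y" by blast
      then have "N = outer u y - M" by (simp add: eq_diff_eq add.commute)
      also have "\<dots> = outer u (y - q)" unfolding q by (simp add: vec_eq_iff algebra_simps)
      finally show False using N(2) by blast
    qed
  qed
  with nz show ?thesis by blast
qed

lemma exists_other_index:
  fixes a :: "'n::finite"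
  assumes "CARD('n) \<ge> 2"
  obtains b :: 'n where "b \<noteq> a"
proof -
  have "card {a} \<noteq> CARD('n)"
    using assms by simp
  then have "UNIV \<noteq> {a}"
    by metis
  then show thesis using that by blast
qed

text \<open>Each component of \<open>W\<close> has a common factor, whose side and direction may
  depend on the component; the dimension count makes the components independent and so removes this
  dependence. Dimensions are real: \<open>DIM(complex ^ 'n ^ 'm)\<close> is 2 m n.\<close>

lemma RANK1_subspace_eq:
  fixes W :: "('n::finite, 'm::finite) mats set"
  assumes n: "CARD('n) \<ge> 2" and W: "subspace W" "W \<subseteq> RANK1"
    and dim: "dim W = DIM(complex ^ 'n ^ 'm)"
  shows "\<exists>w. w \<noteq> 0 \<and> (W = right_space w \<or> W = left_space w)"
proof -
  \<comment> \<open>\<open>r\<close> records whether the common factor \<open>z\<close> stands on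
    the right.\<close>
  have "\<exists>r z. z \<noteq> 0 \<and> (\<forall>X\<in>W. \<exists>y. X $ k = (if r then outer y z else outer z y))" for k
  proof -
    have "rank_le_1 M" if M: "M \<in> (\<lambda>X. X $ k) ` W" for M
    proof -
      obtain X where X: "X \<in> W" "M = X $ k" using M by blast
      then show ?thesis
        using RANK1_D[of X "axis k 1"] W(2) by (auto simp: pencil_axis)
    qed
    moreover have "M + N \<in> (\<lambda>X. X $ k) ` W"
      if "M \<in> (\<lambda>X. X $ k) ` W" "N \<in> (\<lambda>X. X $ k) ` W" for M N
      using that subspace_add[OF W(1)] by (auto simp: image_iff) (metis vector_add_component)
    ultimately have "(\<exists>v. v \<noteq> 0 \<and> (\<forall>M\<in>(\<lambda>X. X $ k) ` W. \<exists>y. M = outer y v))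
        \<or> (\<exists>u. u \<noteq> 0 \<and> (\<forall>M\<in>(\<lambda>X. X $ k) ` W. \<exists>y. M = outer u y))"
      by (rule rank_le_1_additive_set)
    then show ?thesis
    proof
      assume "\<exists>v. v \<noteq> 0 \<and> (\<forall>M\<in>(\<lambda>X. X $ k) ` W. \<exists>y. M = outer y v)"
      then show ?thesis by (intro exI[of _ True]) auto
    next
      assume "\<exists>u. u \<noteq> 0 \<and> (\<forall>M\<in>(\<lambda>X. X $ k) ` W. \<exists>y. M = outer u y)"
      then show ?thesis by (intro exI[of _ False]) auto
    qed
  qed
  then obtain r z where z: "\<And>k. z k \<noteq> 0"
    and rz: "\<And>k X. X \<in> W \<Longrightarrow> \<exists>y. X $ k = (if r k then outer y (z k) else outer (z k) y)"
    by metis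
  \<comment> \<open>By dimension, \<open>W\<close> is the full product of the slot-wise spaces; sums of two independent slots
    then force all slots to have the same kind and direction.\<close>
  define \<Phi> :: "complex ^ 'n ^ 'm \<Rightarrow> ('n, 'm) mats" where
    "\<Phi> y = (\<chi> k. if r k then outer (y $ k) (z k) else outer (z k) (y $ k))" for y
  have lin: "linear \<Phi>"
    by (rule linearI) (auto simp: \<Phi>_def vec_eq_iff algebra_simps)
  have "W \<subseteq> range \<Phi>"
  proof
    fix X assume "X \<in> W"
    then obtain y where "\<And>k. X $ k = (if r k then outer (y k) (z k) else outer (z k) (y k))"
      using rz by metis
    then have "X = \<Phi> (\<chi> k. y k)"
      by (subst vec_eq_iff) (simp add: \<Phi>_def)
    then show "X \<in> range \<Phi>" by blast
  qed
  moreover have "dim (range \<Phi>) \<le> dim W"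
    using dim_image_le[OF lin, of UNIV] dim by (simp add: dim_UNIV)
  ultimately have W_eq: "W = range \<Phi>"
    using subspace_dim_equal[OF W(1)] linear_subspace_image[OF lin subspace_UNIV] by blast
  \<comment> \<open>The sum of two components is the pencil at the sum of two coordinate
    vectors.\<close>
  have rank: "rank_le_1 (\<Phi> y $ k + \<Phi> y $ l)" if "k \<noteq> l" for y k l
  proof -
    have "\<Phi> y \<in> RANK1"
      using W W_eq by blast
    then show ?thesis
      using RANK1_D[of "\<Phi> y" "axis k 1 + axis l 1"] by (simp add: pencil_add_arg pencil_axis)
  qed
  \<comment> \<open>Slot \<open>k\<close> and any other slot can be filled independently.\<close>
  define y where "y k p q = (\<chi> i. if i = k then p else q)" for k :: 'm and p q :: "complex ^ 'n"
  \<comment> \<open>With \<open>a \<noteq> c\<close> and \<open>d \<noteq> b\<close>, both factors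
    of the minor in rows \<open>a\<close>, \<open>c\<close> and columns \<open>b\<close>,
    \<open>d\<close> are nonzero.\<close>
  have r_eq: False if kl: "k \<noteq> l" and r: "r k" "\<not> r l" for k l
  proof -
    obtain c where c: "z l $ c \<noteq> 0" using z[of l] by (auto simp: vec_eq_iff)
    obtain a where a: "a \<noteq> c" using exists_other_index[OF n] .
    obtain b where b: "z k $ b \<noteq> 0" using z[of k] by (auto simp: vec_eq_iff)
    obtain d where d: "d \<noteq> b" using exists_other_index[OF n] .
    have "rank_le_1 (outer (axis a 1) (z k) + outer (z l) (axis d 1))"
      using rank[OF kl, of "y k (axis a 1) (axis d 1)"] kl r by (simp add: \<Phi>_def y_def)
    from rank_le_1_add_outer[OF this, of a c b d] show False
      using a b c d by (simp add: axis_def)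
  qed
  \<comment> \<open>Distinct unit vectors in the free factors are not parallel, so the fixed factors
    must be.\<close>
  have par: "z k $ b * z l $ d = z k $ d * z l $ b" if kl: "k \<noteq> l" for k l b d
  proof -
    obtain a c :: 'n where c: "c \<noteq> a" using exists_other_index[OF n] .
    let ?\<Phi> = "\<Phi> (y k (axis a 1) (axis c 1))"
    have *: "rank_le_1 (?\<Phi> $ k + ?\<Phi> $ l)"
      using rank[OF kl] .
    show ?thesis
    proof (cases "r k")
      case True
      then have "r l" using r_eq[of k l] kl True by auto
      then have "rank_le_1 (outer (axis a 1) (z k) + outer (axis c 1) (z l))"
        using * True kl by (simp add: \<Phi>_def y_def)
      from rank_le_1_add_outer[OF this, of a c b d] show ?thesis
        using c by (simp add: axis_def)
    next
      case False
      then have "\<not> r l" using r_eq[of l k] kl False by auto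
      then have "rank_le_1 (outer (z k) (axis a 1) + outer (z l) (axis c 1))"
        using * False kl by (simp add: \<Phi>_def y_def)
      from rank_le_1_add_outer[OF this, of b d a c] show ?thesis
        using c by (simp add: axis_def)
    qed
  qed
  \<comment> \<open>An arbitrary slot for reference.\<close>
  define k0 :: 'm where "k0 = undefined"
  define w where "w = z k0"
  have "\<exists>c. c \<noteq> 0 \<and> z k = c *s w" for k
  proof (cases "k = k0")
    case True
    then show ?thesis by (intro exI[of _ 1]) (simp add: w_def)
  next
    case False
    then have "w $ b * z k $ d = w $ d * z k $ b" for b d
      using par[of k0 k] by (simp add: w_def)
    moreover have "w \<noteq> 0"
      using z w_def by simp
    ultimately obtain c where "z k = c *s w"
      using parallel_obtain by blast
    then show ?thesis using z[of k] by (intro exI[of _ c]) auto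
  qed
  then obtain c where c: "\<And>k. c k \<noteq> 0" "\<And>k. z k = c k *s w" by metis
  have r: "r k \<longleftrightarrow> r k0" for k
    using r_eq[of k k0] r_eq[of k0 k] by (cases "k = k0") auto
  have scale: "outer (s *s p) (t *s q) = outer ((s * t) *s p) q"
    "outer (s *s p) (t *s q) = outer p ((s * t) *s q)" for s t and p q :: "complex ^ 'n"
    by (simp_all add: vec_eq_iff)
  show ?thesis
  proof (cases "r k0")
    case True
    then have \<Phi>: "\<Phi> y $ k = outer (y $ k) (c k *s w)" for y k
      using r by (simp add: \<Phi>_def c(2))
    have "range \<Phi> = right_space w"
    proof (intro equalityI subsetI)
      fix X assume "X \<in> range \<Phi>"
      then obtain y where "X = \<Phi> y" by blast
      then have "X $ k = outer (c k *s y $ k) w" for k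
        by (simp add: \<Phi> vec_eq_iff)
      then show "X \<in> right_space w" by (rule right_space_I)
    next
      fix X :: "('n, 'm) mats" assume "X \<in> right_space w"
      then obtain y where y: "\<And>k. X $ k = outer (y k) w"
        using right_space_E by blast
      have "X = \<Phi> (\<chi> k. (1 / c k) *s y k)"
        using c(1) by (simp add: \<Phi> y vec_eq_iff)
      then show "X \<in> range \<Phi>" by blast
    qed
    then show ?thesis using W_eq z w_def by blast
  next
    case False
    then have \<Phi>: "\<Phi> y $ k = outer (c k *s w) (y $ k)" for y k
      using r by (simp add: \<Phi>_def c(2))
    have "range \<Phi> = left_space w"
    proof (intro equalityI subsetI)
      fix X assume "X \<in> range \<Phi>"
      then obtain y where "X = \<Phi> y" by blast
      then have "X $ k = outer w (c k *s y $ k)" for k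
        by (simp add: \<Phi> vec_eq_iff)
      then show "X \<in> left_space w" by (rule left_space_I)
    next
      fix X :: "('n, 'm) mats" assume "X \<in> left_space w"
      then obtain y where y: "\<And>k. X $ k = outer w (y k)"
        using left_space_E by blast
      have "X = \<Phi> (\<chi> k. (1 / c k) *s y k)"
        using c(1) by (simp add: \<Phi> y vec_eq_iff)
      then show "X \<in> range \<Phi>" by blast
    qed
    then show ?thesis using W_eq z w_def by blast
  qed
qed


section \<open>Images of the two kinds of spaces under a symmetry\<close>

lemma right_space_linear: "linear (\<lambda>y. \<chi> k. outer (y $ k) v)"
  by (rule linearI) (simp_all add: vec_eq_iff algebra_simps)

lemma left_space_linear: "linear (\<lambda>y. \<chi> k. outer u (y $ k))"
  by (rule linearI) (simp_all add: vec_eq_iff algebra_simps)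

lemma dim_right_space:
  assumes "v \<noteq> 0"
  shows "dim (right_space v :: ('n::finite, 'm::finite) mats set) = DIM(complex ^ 'n ^ 'm)"
proof -
  obtain b where b: "v $ b \<noteq> 0"
    using assms by (auto simp: vec_eq_iff)
  have "inj (\<lambda>y :: complex ^ 'n ^ 'm. (\<chi> k. outer (y $ k) v) :: ('n, 'm) mats)"
  proof (rule injI)
    fix x y :: "complex ^ 'n ^ 'm"
    assume eq: "((\<chi> k. outer (x $ k) v) :: ('n, 'm) mats) = (\<chi> k. outer (y $ k) v)"
    have "x $ k $ a * v $ b = y $ k $ a * v $ b" for k a
      using arg_cong[OF eq, of "\<lambda>X. X $ k $ a $ b"] by simp
    then show "x = y"
      using b by (simp add: vec_eq_iff)
  qed
  then show ?thesis
    unfolding right_space_def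
    by (subst dim_image_eq[OF right_space_linear]) (auto simp: inj_on_subset dim_UNIV)
qed

lemma dim_left_space:
  assumes "u \<noteq> 0"
  shows "dim (left_space u :: ('n::finite, 'm::finite) mats set) = DIM(complex ^ 'n ^ 'm)"
proof -
  obtain a where a: "u $ a \<noteq> 0"
    using assms by (auto simp: vec_eq_iff)
  have "inj (\<lambda>y :: complex ^ 'n ^ 'm. (\<chi> k. outer u (y $ k)) :: ('n, 'm) mats)"
  proof (rule injI)
    fix x y :: "complex ^ 'n ^ 'm"
    assume eq: "((\<chi> k. outer u (x $ k)) :: ('n, 'm) mats) = (\<chi> k. outer u (y $ k))"
    have "u $ a * x $ k $ b = u $ a * y $ k $ b" for k b
      using arg_cong[OF eq, of "\<lambda>X. X $ k $ a $ b"] by simp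
    then show "x = y"
      using a by (simp add: vec_eq_iff)
  qed
  then show ?thesis
    unfolding left_space_def
    by (subst dim_image_eq[OF left_space_linear]) (auto simp: inj_on_subset dim_UNIV)
qed

text \<open>Passes from complex to real linearity, the setting of \<open>subspace\<close> and
  \<open>dim\<close>.\<close>

lemma GL_mats_linear:
  fixes g :: "('n::finite, 'm::finite) mats \<Rightarrow> ('n, 'm) mats"
  assumes "g \<in> carrier GL_mats"
  shows "linear g"
proof (rule linearI)
  show "g (x + y) = g x + g y" for x y
    using assms by (auto simp: GL_mats_def linear_mats_iff)
  have "r *\<^sub>R x = mats_scale (of_real r) x" for r and x :: "('n, 'm) mats"
    unfolding vec_eq_iff mats_scale_def mat_scale_def vector_scaleR_component
    by (simp add: scaleR_conv_of_real[where 'a=complex])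
  then show "g (r *\<^sub>R x) = r *\<^sub>R g x" for r x
    using assms by (auto simp: GL_mats_def linear_mats_iff)
qed

text \<open>The image is a subspace of the rank-one set of the same dimension, so the classification
  applies to it.\<close>

lemma symmetry_image_space:
  fixes g :: "('n::finite, 'm::{finite,linorder}) mats \<Rightarrow> ('n, 'm) mats"
  assumes n: "CARD('n) \<ge> 2" and g: "g \<in> symmetries SING"
    and v: "v \<noteq> 0" and U: "U = right_space v \<or> U = left_space v"
  shows "\<exists>w. w \<noteq> 0 \<and> (g ` U = right_space w \<or> g ` U = left_space w)"
proof (rule RANK1_subspace_eq[OF n])
  have lin: "linear g" and inj: "inj g"
    using g by (auto simp: symmetries_def GL_mats_linear) (simp add: GL_mats_def bij_is_inj)
  have "subspace U"
    using U linear_subspace_image[OF right_space_linear subspace_UNIV]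
      linear_subspace_image[OF left_space_linear subspace_UNIV]
    unfolding right_space_def left_space_def by blast
  then show "subspace (g ` U)"
    by (rule linear_subspace_image[OF lin])
  have "U \<subseteq> RANK1"
    using U right_space_RANK1 left_space_RANK1 by blast
  then show "g ` U \<subseteq> RANK1"
    using symmetry_SING_RANK1_iff[OF g] by blast
  have "dim (g ` U) = dim U"
    using inj by (intro dim_image_eq[OF lin]) (rule inj_on_subset, auto)
  then show "dim (g ` U) = DIM(complex ^ 'n ^ 'm::{finite,linorder})"
    using U dim_right_space[OF v] dim_left_space[OF v] by metis
qed

lemma right_space_scale:
  assumes "c \<noteq> 0"
  shows "right_space (c *s v) = right_space v"
proof (intro equalityI subsetI)
  fix X assume "X \<in> right_space (c *s v)"
  then obtain y where y: "\<And>k. X $ k = outer (y k) (c *s v)"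
    using right_space_E by blast
  show "X \<in> right_space v"
    by (rule right_space_I[of _ "\<lambda>k. c *s y k"]) (simp add: y vec_eq_iff)
next
  fix X assume "X \<in> right_space v"
  then obtain y where y: "\<And>k. X $ k = outer (y k) v"
    using right_space_E by blast
  show "X \<in> right_space (c *s v)"
    by (rule right_space_I[of _ "\<lambda>k. (1 / c) *s y k"]) (use assms in \<open>simp add: y vec_eq_iff\<close>)
qed

section \<open>Transposition and intersections of the two kinds of spaces\<close>

lemma \<tau>_nth: "\<tau> X $ k $ a $ b = X $ k $ b $ a"
  by (simp add: \<tau>_def transpose_def)

lemma \<tau>_\<tau>: "\<tau> (\<tau> X) = X"
  by (simp add: vec_eq_iff \<tau>_nth)

lemma \<tau>_right_space:
  fixes v :: "complex ^ 'n::finite"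
  shows "\<tau> ` right_space v = (left_space v :: ('n, 'm::finite) mats set)"
proof -
  have "\<tau> (\<chi> k. outer (y $ k) v) = (\<chi> k. outer v (y $ k))" for y :: "complex ^ 'n ^ 'm"
    by (simp add: vec_eq_iff \<tau>_nth)
  then show ?thesis
    by (simp add: right_space_def left_space_def image_image)
qed

lemma \<tau>_left_space:
  fixes v :: "complex ^ 'n::finite"
  shows "\<tau> ` left_space v = (right_space v :: ('n, 'm::finite) mats set)"
proof -
  have "\<tau> (\<chi> k. outer v (y $ k)) = (\<chi> k. outer (y $ k) v)" for y :: "complex ^ 'n ^ 'm"
    by (simp add: vec_eq_iff \<tau>_nth)
  then show ?thesis
    by (simp add: right_space_def left_space_def image_image)
qed

text \<open>A nonzero tensor in a right space determines the last factor up to a nonzero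
  scalar.\<close>

lemma right_space_Int_right_space:
  assumes "X \<in> right_space v" "X \<in> right_space w" "X \<noteq> 0"
  shows "right_space v = right_space w"
proof -
  obtain y where y: "\<And>k. X $ k = outer (y k) v"
    using assms(1) right_space_E by blast
  obtain z where z: "\<And>k. X $ k = outer (z k) w"
    using assms(2) right_space_E by blast
  obtain k a b where kab: "X $ k $ a $ b \<noteq> 0"
    using assms(3) by (auto simp: vec_eq_iff)
  have X: "X $ k $ a $ d = y k $ a * v $ d" "X $ k $ a $ d = z k $ a * w $ d" for d
    by (simp add: y) (simp add: z)
  have nz: "y k $ a \<noteq> 0" "z k $ a \<noteq> 0"
    using kab X[of b] by auto
  have "y k $ a * v $ d = z k $ a * w $ d" for d
    using X[of d] by simp
  then have "v = (z k $ a / y k $ a) *s w"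
    using nz by (simp add: vec_eq_iff field_simps)
  then show ?thesis
    using nz right_space_scale[of "z k $ a / y k $ a" w] by simp
qed

lemma right_space_Int_left_space:
  assumes "v \<noteq> 0" "u \<noteq> 0"
  obtains X :: "('n::finite, 'm::finite) mats"
  where "X \<in> right_space v" "X \<in> left_space u" "X \<noteq> 0"
proof -
  define X :: "('n, 'm) mats" where "X = (\<chi> k. outer u v)"
  have "X \<in> right_space v" "X \<in> left_space u"
    unfolding X_def by (rule right_space_I left_space_I, simp)+
  moreover have "X \<noteq> 0"
    using assms by (auto simp: X_def vec_eq_iff)
  ultimately show thesis by (rule that)
qed

text \<open>The middle factor is free in a right space, and for n \<ge> 2 some unit vector is not a
  multiple of \<open>u\<close>.\<close>

lemma right_space_neq_left_space:
  assumes "CARD('n::finite) \<ge> 2" and v: "v \<noteq> 0" and u: "u \<noteq> 0"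
  shows "(right_space v :: ('n, 'm::finite) mats set) \<noteq> left_space u"
proof
  assume eq: "(right_space v :: ('n, 'm) mats set) = left_space u"
  obtain b where b: "v $ b \<noteq> 0" using v by (auto simp: vec_eq_iff)
  obtain c where c: "u $ c \<noteq> 0" using u by (auto simp: vec_eq_iff)
  obtain a where a: "a \<noteq> c" using exists_other_index[OF assms(1)] .
  have "((\<chi> k. outer (axis a 1) v) :: ('n, 'm) mats) \<in> right_space v"
    by (rule right_space_I[of _ "\<lambda>k. axis a 1"]) simp
  then have "((\<chi> k. outer (axis a 1) v) :: ('n, 'm) mats) \<in> left_space u"
    using eq by simp
  then obtain y where y: "\<And>k. (((\<chi> k. outer (axis a 1) v) :: ('n, 'm) mats)) $ k = outer u (y k)"
    using left_space_E by blast
  have *: "axis a 1 $ i * v $ b = u $ i * y k $ b" for k :: 'm and i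
    using arg_cong[OF y[of k], of "\<lambda>M. M $ i $ b"] by simp
  from *[of c] have "y k $ b = 0" for k
    using a c by (simp add: axis_def)
  with *[of a] show False
    using b by simp
qed

text \<open>Inclusions are enough here: only where the images of pure tensors land is used to
  reconstruct \<open>g\<close>.\<close>

definition keeps_sides :: "(('n::finite, 'm::finite) mats \<Rightarrow> ('n, 'm) mats) \<Rightarrow> bool" where
  "keeps_sides g \<longleftrightarrow>
     (\<forall>v. v \<noteq> 0 \<longrightarrow> (\<exists>w. w \<noteq> 0 \<and> g ` right_space v \<subseteq> right_space w)) \<and>
     (\<forall>u. u \<noteq> 0 \<longrightarrow> (\<exists>w. w \<noteq> 0 \<and> g ` left_space u \<subseteq> left_space w))"

text \<open>A right and a left space share a nonzero tensor, so two right spaces as images would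
  coincide, against injectivity.\<close>

lemma not_both_right:
  fixes g :: "('n::finite, 'm::finite) mats \<Rightarrow> ('n, 'm) mats"
  assumes n: "CARD('n) \<ge> 2" and g: "inj g" "g 0 = 0"
    and vu: "v \<noteq> 0" "u \<noteq> 0"
    and im: "g ` right_space v = right_space w" "g ` left_space u = right_space w'"
  shows False
proof -
  obtain X :: "('n, 'm) mats" where X: "X \<in> right_space v" "X \<in> left_space u" "X \<noteq> 0"
    using right_space_Int_left_space[OF vu] .
  have "g X \<noteq> 0"
    using g X(3) by (metis injD)
  moreover have "g X \<in> right_space w" "g X \<in> right_space w'"
    using X im by blast+
  ultimately have "right_space w = (right_space w' :: ('n, 'm) mats set)"
    by (intro right_space_Int_right_space)
  then have "g ` right_space v = g ` left_space u"
    using im by simp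
  then have "right_space v = (left_space u :: ('n, 'm) mats set)"
    using g(1) by (simp add: inj_image_eq_iff)
  then show False
    using right_space_neq_left_space[OF n vu] by blast
qed

text \<open>One right space with right image forces all left spaces to have left images, and these
  in turn force all right images to be right. Otherwise every right space is sent to a left one and
  \<open>\<tau>\<close> repairs the sides.\<close>

lemma symmetry_keeps_sides:
  fixes g :: "('n::finite, 'm::{finite,linorder}) mats \<Rightarrow> ('n, 'm) mats"
  assumes g: "g \<in> symmetries SING"
  shows "keeps_sides g \<or> keeps_sides (\<tau> \<circ> g)"
proof (cases "CARD('n) \<ge> 2")
  case False
  then have n1: "CARD('n) = 1"
    using zero_less_card_finite[where 'a='n] by linarith
  then have eq: "a = b" for a b :: 'n
    by (metis UNIV_I card_1_singletonE singletonD)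
  \<comment> \<open>For n = 1 a nonzero vector spans, so both kinds of spaces are
    everything.\<close>
  have "right_space v = (UNIV :: ('n, 'm) mats set)" "left_space v = (UNIV :: ('n, 'm) mats set)" if v: "v \<noteq> 0" for v :: "complex ^ 'n"
  proof -
    have nz: "v $ b \<noteq> 0" for b
      using v eq by (metis vec_eq_iff zero_index)
    have "X \<in> right_space v" for X :: "('n, 'm) mats"
    proof -
      have "X $ k $ a $ b = X $ k $ a $ a / v $ a * v $ b" for k a b
        using nz[of b] eq[of a b] by simp
      then have "X $ k = outer (\<chi> a. X $ k $ a $ a / v $ a) v" for k
        unfolding vec_eq_iff outer_nth vec_lambda_beta by blast
      then show ?thesis
        by (rule right_space_I)
    qed
    then show "right_space v = (UNIV :: ('n, 'm) mats set)" by blast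
    have "X \<in> left_space v" for X :: "('n, 'm) mats"
    proof -
      have "X $ k $ a $ b = v $ a * (X $ k $ b $ b / v $ b)" for k a b
        using nz[of b] eq[of a b] by simp
      then have "X $ k = outer v (\<chi> b. X $ k $ b $ b / v $ b)" for k
        unfolding vec_eq_iff outer_nth vec_lambda_beta by blast
      then show ?thesis
        by (rule left_space_I)
    qed
    then show "left_space v = (UNIV :: ('n, 'm) mats set)" by blast
  qed
  then have "g ` right_space v \<subseteq> right_space v \<and> g ` left_space v \<subseteq> left_space v"
    if "v \<noteq> 0" for v
    using that by simp
  then have "keeps_sides g"
    unfolding keeps_sides_def by blast
  then show ?thesis ..
next
  case n: True
  note space = symmetry_image_space[OF n g]
  have lin: "linear g" and inj: "inj g"
    using g by (auto simp: symmetries_def GL_mats_linear) (simp add: GL_mats_def bij_is_inj)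
  have g0: "g 0 = 0"
    using lin by (rule linear_0)
  have inj': "inj (\<tau> \<circ> g)"
    by (rule inj_compose[OF _ inj]) (rule inj_on_inverseI[of _ \<tau>], rule \<tau>_\<tau>)
  have g0': "(\<tau> \<circ> g) 0 = 0"
    by (simp add: g0 vec_eq_iff \<tau>_nth)
  have \<tau>_im: "(\<tau> \<circ> g) ` U = \<tau> ` (g ` U)" for U
    by (simp add: image_comp)
  have one: "(1 :: complex ^ 'n) \<noteq> 0"
    by (simp add: vec_eq_iff)
  show ?thesis
  proof (cases "\<exists>v w. v \<noteq> 0 \<and> w \<noteq> 0 \<and> g ` right_space v = right_space w")
    case True
    then obtain v0 w0 where v0: "v0 \<noteq> 0" "w0 \<noteq> 0" "g ` right_space v0 = right_space w0"
      by blast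
    have left: "\<exists>w. w \<noteq> 0 \<and> g ` left_space u = left_space w" if u: "u \<noteq> 0" for u
      using space[OF u, of "left_space u"] not_both_right[OF n inj g0 v0(1) u v0(3)] by blast
    then obtain w1 where w1: "w1 \<noteq> 0" "g ` left_space 1 = left_space w1"
      using one by blast
    have right: "\<exists>w. w \<noteq> 0 \<and> g ` right_space v = right_space w" if v: "v \<noteq> 0" for v
    proof (rule ccontr)
      assume "\<not> ?thesis"
      then obtain w where "g ` right_space v = left_space w"
        using space[OF v, of "right_space v"] by blast
      \<comment> \<open>After composition with \<open>\<tau>\<close>, a right and a left space would
        both have right images.\<close>
      then show False
        using not_both_right[OF n inj' g0' v one, of w w1, unfolded \<tau>_im] w1
        by (simp add: \<tau>_left_space)
    qed
    have "keeps_sides g"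
      unfolding keeps_sides_def
    proof (intro conjI allI impI)
      fix v :: "complex ^ 'n" assume "v \<noteq> 0"
      then show "\<exists>w. w \<noteq> 0 \<and> g ` right_space v \<subseteq> right_space w"
        using right[of v] by auto
    next
      fix v :: "complex ^ 'n" assume "v \<noteq> 0"
      then show "\<exists>w. w \<noteq> 0 \<and> g ` left_space v \<subseteq> left_space w"
        using left[of v] by auto
    qed
    then show ?thesis ..
  next
    case False
    have right: "\<exists>w. w \<noteq> 0 \<and> g ` right_space v = left_space w" if v: "v \<noteq> 0" for v
      using space[OF v, of "right_space v"] False v by blast
    then obtain w1 where w1: "w1 \<noteq> 0" "g ` right_space 1 = left_space w1"
      using one by blast
    have left: "\<exists>w. w \<noteq> 0 \<and> g ` left_space u = right_space w" if u: "u \<noteq> 0" for u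
    proof (rule ccontr)
      assume "\<not> ?thesis"
      then obtain w where "g ` left_space u = left_space w"
        using space[OF u, of "left_space u"] by blast
      then show False
        using not_both_right[OF n inj' g0' one u, of w1 w, unfolded \<tau>_im] w1
        by (simp add: \<tau>_left_space)
    qed
    have "keeps_sides (\<tau> \<circ> g)"
      unfolding keeps_sides_def \<tau>_im
    proof (intro conjI allI impI)
      fix v :: "complex ^ 'n" assume "v \<noteq> 0"
      then obtain w where "w \<noteq> 0" "g ` right_space v = left_space w"
        using right by blast
      then show "\<exists>w. w \<noteq> 0 \<and> \<tau> ` g ` right_space v \<subseteq> right_space w"
        by (intro exI[of _ w]) (simp add: \<tau>_left_space)
    next
      fix v :: "complex ^ 'n" assume "v \<noteq> 0"
      then obtain w where "w \<noteq> 0" "g ` left_space v = right_space w"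
        using left by blast
      then show "\<exists>w. w \<noteq> 0 \<and> \<tau> ` g ` left_space v \<subseteq> left_space w"
        by (intro exI[of _ w]) (simp add: \<tau>_right_space)
    qed
    then show ?thesis ..
  qed
qed


section \<open>Linear maps preserving both kinds of spaces\<close>

definition tens :: "complex ^ 'm \<Rightarrow> complex ^ 'n \<Rightarrow> complex ^ 'n \<Rightarrow> ('n::finite, 'm::finite) mats" where
  "tens x u v = (\<chi> k a b. x $ k * u $ a * v $ b)"

lemma tens_nth [simp]: "tens x u v $ k $ a $ b = x $ k * u $ a * v $ b"
  by (simp add: tens_def)

lemma tens_right_space: "tens x u v \<in> right_space v"
  by (rule right_space_I[of _ "\<lambda>k. x $ k *s u"]) (simp add: vec_eq_iff)

lemma tens_left_space: "tens x u v \<in> left_space u"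
  by (rule left_space_I[of _ _ "\<lambda>k. x $ k *s v"]) (simp add: vec_eq_iff)

text \<open>Row \<open>c\<close>, where \<open>u $ c \<noteq> 0\<close>, shows that each
  \<open>z k\<close> acts as a multiple of \<open>v\<close>; the multiples are the entries of
  \<open>x\<close>.\<close>

lemma right_left_space_tens:
  assumes "X \<in> right_space v" "X \<in> left_space u" "u \<noteq> 0"
  obtains x where "X = tens x u v"
proof -
  obtain y where y: "\<And>k. X $ k = outer (y k) v"
    using assms(1) right_space_E by blast
  obtain z where z: "\<And>k. X $ k = outer u (z k)"
    using assms(2) left_space_E by blast
  obtain c where c: "u $ c \<noteq> 0"
    using assms(3) by (auto simp: vec_eq_iff)
  have Xy: "X $ k $ a $ b = y k $ a * v $ b" for k a b by (simp add: y)
  have Xz: "X $ k $ a $ b = u $ a * z k $ b" for k a b by (simp add: z)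
  have "X $ k $ a $ b = (\<chi> k. y k $ c / u $ c) $ k * u $ a * v $ b" for k a b
    using Xy[of k c b] Xz[of k c b] Xz[of k a b] c by (simp add: field_simps)
  then have "X = tens (\<chi> k. y k $ c / u $ c) u v"
    unfolding vec_eq_iff tens_nth by blast
  then show thesis by (rule that)
qed

lemma sum_axis: "(\<Sum>i\<in>UNIV. f i * axis i (1::complex) $ a) = f a"
  by (simp add: axis_def if_distrib[of "\<lambda>x. _ * x"] cong: if_cong)

lemma sum_axis_one: "(\<Sum>i\<in>UNIV. axis i (1::complex) $ a) = 1"
  using sum_axis[of "\<lambda>_. 1" a] by simp

text \<open>If the vectors \<open>h i\<close> were dependent, a nonzero \<open>z\<close> would
  annihilate all of them and hence the columns of every \<open>g Y\<close>, against
  surjectivity.\<close>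

lemma invertible_left_directions:
  fixes g :: "('n::finite, 'm::finite) mats \<Rightarrow> ('n, 'm) mats"
  assumes lin: "linear g" and surj: "surj g"
    and h: "\<And>i. g ` left_space (axis i 1) \<subseteq> left_space (h i)"
  shows "invertible (\<chi> a i. h i $ a)"
proof -
  define H :: "complex ^ 'n ^ 'n" where "H = (\<chi> a i. h i $ a)"
  have "z = 0" if z: "transpose H *v z = 0" for z
  proof -
    have orth: "(\<Sum>a\<in>UNIV. z $ a * h i $ a) = 0" for i
      using z by (simp add: vec_eq_iff matrix_vector_mult_def H_def transpose_def mult.commute)
    have vanish: "(\<Sum>a\<in>UNIV. z $ a * g Y $ k $ a $ b) = 0" for Y k b
    proof -
      \<comment> \<open>\<open>R i\<close> keeps only row \<open>i\<close> of every component, so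
        \<open>Y\<close> splits into members of the given left spaces.\<close>
      define R where "R i = ((\<chi> l. outer (axis i 1) (Y $ l $ i)) :: ('n, 'm) mats)" for i
      have "Y = (\<Sum>i\<in>UNIV. R i)"
        by (simp add: vec_eq_iff R_def mult.commute[of _ "_ $ _ $ _ $ _"] sum_axis)
      then have gY: "g Y = (\<Sum>i\<in>UNIV. g (R i))"
        by (simp add: linear_sum[OF lin])
      have "(\<Sum>a\<in>UNIV. z $ a * g (R i) $ k $ a $ b) = 0" for i
      proof -
        have "R i \<in> left_space (axis i 1)"
          unfolding R_def by (rule left_space_I) simp
        then obtain y where y: "\<And>k. g (R i) $ k = outer (h i) (y k)"
          using h left_space_E by (metis image_subset_iff)
        have "(\<Sum>a\<in>UNIV. z $ a * g (R i) $ k $ a $ b) = (\<Sum>a\<in>UNIV. z $ a * h i $ a) * y k $ b"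
          by (simp add: y sum_distrib_right mult.assoc)
        then show ?thesis by (simp add: orth)
      qed
      then have "(\<Sum>i\<in>UNIV. \<Sum>a\<in>UNIV. z $ a * g (R i) $ k $ a $ b) = 0"
        by simp
      then show ?thesis
        unfolding gY by (subst (asm) sum.swap) (simp add: sum_distrib_left)
    qed
    have "z $ c = 0" for c
    proof -
      \<comment> \<open>All columns of this image are the unit vector at \<open>c\<close>, which
        isolates \<open>z $ c\<close>.\<close>
      obtain Y where "g Y = (\<chi> k a b. axis a 1 $ c)"
        using surj by (metis surjD)
      then show ?thesis
        using vanish[of Y undefined undefined] by (simp add: sum_axis)
    qed
    then show "z = 0" by (simp add: vec_eq_iff)
  qed
  then have "det (transpose H) \<noteq> 0"
    using invertible_left_inverse matrix_left_invertible_ker invertible_det_nz by blast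
  then show ?thesis
    by (simp add: invertible_det_nz H_def)
qed

lemma \<tau>_linear: "linear \<tau>"
  by (rule linearI) (simp_all add: vec_eq_iff \<tau>_nth)

lemma surj_\<tau>: "surj \<tau>"
  by (rule surjI[of _ \<tau>]) (rule \<tau>_\<tau>)

text \<open>Conjugation by \<open>\<tau>\<close> exchanges the two kinds of spaces.\<close>

lemma invertible_right_directions:
  fixes g :: "('n::finite, 'm::finite) mats \<Rightarrow> ('n, 'm) mats"
  assumes lin: "linear g" and surj: "surj g"
    and f: "\<And>i. g ` right_space (axis i 1) \<subseteq> right_space (f i)"
  shows "invertible (\<chi> a i. f i $ a)"
proof (rule invertible_left_directions[of "\<tau> \<circ> g \<circ> \<tau>"])
  show "linear (\<tau> \<circ> g \<circ> \<tau>)"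
    by (intro linear_compose \<tau>_linear lin)
  show "surj (\<tau> \<circ> g \<circ> \<tau>)"
    by (intro comp_surj surj_\<tau> surj)
  show "(\<tau> \<circ> g \<circ> \<tau>) ` left_space (axis i 1) \<subseteq> left_space (f i)" for i
  proof -
    have "(\<tau> \<circ> g \<circ> \<tau>) ` left_space (axis i 1) = \<tau> ` g ` \<tau> ` left_space (axis i 1)"
      by (simp only: image_comp comp_assoc)
    also have "\<dots> \<subseteq> \<tau> ` right_space (f i)"
      using f[of i] by (simp add: \<tau>_left_space image_mono)
    finally show ?thesis by (simp add: \<tau>_right_space)
  qed
qed

section \<open>Coordinates of the action and facts on inverse matrices\<close>

lemma act_nth:
  "act P Q R X $ k $ a $ b = (\<Sum>l\<in>UNIV. P $ k $ l * (Q ** X $ l ** matrix_inv R) $ a $ b)"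
  by (simp add: act_def mat_scale_def)

lemma matrix_triple_nth:
  fixes M :: "'a::comm_semiring_1 ^ 'k::finite ^ 'l::finite"
  shows "(Q ** M ** S) $ a $ b = (\<Sum>i\<in>UNIV. \<Sum>j\<in>UNIV. M $ i $ j * (Q $ a $ i * S $ j $ b))"
  unfolding matrix_matrix_mult_def
  by (simp add: sum_distrib_right, subst sum.swap, intro sum.cong refl, simp add: mult_ac)

lemma matrix_inv_works:
  fixes A :: "'a::field ^ 'n ^ 'n"
  assumes "invertible A"
  shows "A ** matrix_inv A = mat 1" "matrix_inv A ** A = mat 1"
  using assms someI_ex[of "\<lambda>B. A ** B = mat 1 \<and> B ** A = mat 1"]
  unfolding invertible_def matrix_inv_def by auto

lemma matrix_inv_eqI:
  fixes A :: "'a::field ^ 'n ^ 'n"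
  assumes "A ** B = mat 1" "B ** A = mat 1"
  shows "matrix_inv A = B"
proof -
  have "invertible A" using assms unfolding invertible_def by blast
  then have "matrix_inv A ** (A ** B) = B"
    by (simp add: matrix_mul_assoc matrix_inv_works)
  then show ?thesis by (simp add: assms)
qed

lemma invertible_matrix_inv:
  fixes A :: "'a::field ^ 'n ^ 'n"
  assumes "invertible A"
  shows "invertible (matrix_inv A)" "matrix_inv (matrix_inv A) = A"
  using matrix_inv_works[OF assms] matrix_inv_eqI unfolding invertible_def by blast+

lemma invertible_kerI:
  fixes A :: "'a::field ^ 'n ^ 'n"
  assumes "\<And>x. A *v x = 0 \<Longrightarrow> x = 0"
  shows "invertible A"
  using assms invertible_left_inverse matrix_left_invertible_ker by blast

lemma invertible_ker:
  fixes A :: "'a::field ^ 'n ^ 'n"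
  assumes "invertible A" "A *v x = 0"
  shows "x = 0"
  using assms invertible_left_inverse matrix_left_invertible_ker by blast

lemma invertible_scale_columns:
  fixes A :: "'a::field ^ 'n ^ 'n"
  assumes A: "invertible A" and c: "\<And>i. c i \<noteq> 0"
  shows "invertible (\<chi> a i. c i * A $ a $ i)"
proof (rule invertible_kerI)
  fix x assume x: "(\<chi> a i. c i * A $ a $ i) *v x = 0"
  have "A *v (\<chi> i. c i * x $ i) = 0"
    using x by (simp add: vec_eq_iff matrix_vector_mult_def mult_ac)
  from invertible_ker[OF A this] show "x = 0"
    using c by (simp add: vec_eq_iff)
qed

lemma invertible_transpose:
  fixes A :: "'a::field ^ 'n ^ 'n"
  shows "invertible (transpose A) \<longleftrightarrow> invertible A"
  by (simp add: invertible_det_nz)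

section \<open>Pure tensors and the reconstruction of the three factors\<close>

lemma tens_sum_middle: "tens x 1 v = (\<Sum>i\<in>UNIV. tens x (axis i 1) v)"
  by (simp add: vec_eq_iff sum_axis_one mult.assoc
      flip: sum_distrib_left sum_distrib_right)

lemma tens_sum_right: "tens x u 1 = (\<Sum>j\<in>UNIV. tens x u (axis j 1))"
  by (simp add: vec_eq_iff sum_axis_one flip: sum_distrib_left)

lemma mats_tens_expansion:
  "X = (\<Sum>l\<in>UNIV. \<Sum>i\<in>UNIV. \<Sum>j\<in>UNIV.
      mats_scale (X $ l $ i $ j) (tens (axis l 1) (axis i 1) (axis j 1)))"
proof -
  have "(\<Sum>l\<in>UNIV. \<Sum>i\<in>UNIV. \<Sum>j\<in>UNIV.
      X $ l $ i $ j * (axis l 1 $ k * axis i 1 $ a * axis j 1 $ b)) = X $ k $ a $ b" for k a b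
  proof -
    have "(\<Sum>l\<in>UNIV. \<Sum>i\<in>UNIV. \<Sum>j\<in>UNIV.
        X $ l $ i $ j * (axis l 1 $ k * axis i 1 $ a * axis j 1 $ b))
      = (\<Sum>l\<in>UNIV. (\<Sum>i\<in>UNIV. (\<Sum>j\<in>UNIV. X $ l $ i $ j * axis j 1 $ b) * axis i 1 $ a) * axis l 1 $ k)"
      by (simp only: sum_distrib_right) (intro sum.cong refl, simp add: mult_ac)
    then show ?thesis by (simp only: sum_axis)
  qed
  then show ?thesis
    unfolding vec_eq_iff by (simp add: mats_scale_def mat_scale_def)
qed

text \<open>The images of basis tensors have known last two factors, while the first factor
  \<open>L l i j\<close> may depend on all three indices. Comparison with all-ones vectors shows
  that it is a vector depending on \<open>l\<close> times \<open>c $ i * d $ j\<close>; these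
  scalars are absorbed into the other two factors.\<close>

lemma keeps_sides_G_nm:
  fixes g :: "('n::finite, 'm::finite) mats \<Rightarrow> ('n, 'm) mats"
  assumes g: "g \<in> carrier GL_mats" and keeps: "keeps_sides g"
  shows "g \<in> G_nm"
proof -
  have lin: "linear g" and bij: "bij g"
    and scale: "\<And>c X. g (mats_scale c X) = mats_scale c (g X)"
    using g by (auto simp: GL_mats_linear) (auto simp: GL_mats_def linear_mats_iff)
  have inj: "inj g" and surj: "surj g"
    using bij by (auto simp: bij_is_inj bij_is_surj)
  have g0: "g X = 0 \<longleftrightarrow> X = 0" for X
    using inj linear_0[OF lin] by (metis injD)
  obtain f where f: "\<And>v. v \<noteq> 0 \<Longrightarrow> f v \<noteq> 0"
    "\<And>v. v \<noteq> 0 \<Longrightarrow> g ` right_space v \<subseteq> right_space (f v)"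
    using keeps unfolding keeps_sides_def by metis
  obtain h where h: "\<And>u. u \<noteq> 0 \<Longrightarrow> h u \<noteq> 0"
    "\<And>u. u \<noteq> 0 \<Longrightarrow> g ` left_space u \<subseteq> left_space (h u)"
    using keeps unfolding keeps_sides_def by metis
  \<comment> \<open>A pure tensor lies in a right and a left space, hence so does its image.\<close>
  have g_tens: "\<exists>y. g (tens x u v) = tens y (h u) (f v)" if uv: "u \<noteq> 0" "v \<noteq> 0" for x u v
  proof -
    have "g (tens x u v) \<in> right_space (f v)"
      using f(2)[OF uv(2)] tens_right_space by blast
    moreover have "g (tens x u v) \<in> left_space (h u)"
      using h(2)[OF uv(1)] tens_left_space by blast
    ultimately obtain y where "g (tens x u v) = tens y (h u) (f v)"
      using right_left_space_tens h(1)[OF uv(1)] by blast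
    then show ?thesis by blast
  qed
  define e :: "'n \<Rightarrow> complex ^ 'n" where "e i = axis i 1" for i
  define E :: "'m \<Rightarrow> complex ^ 'm" where "E l = axis l 1" for l
  have e: "e i \<noteq> 0" for i by (simp add: e_def axis_eq_0_iff)
  have one: "(1 :: complex ^ 'n) \<noteq> 0" by (simp add: vec_eq_iff)
  have "\<forall>l i j. \<exists>y. g (tens (E l) (e i) (e j)) = tens y (h (e i)) (f (e j))"
    using g_tens e by blast
  then obtain L where L: "\<And>l i j. g (tens (E l) (e i) (e j)) = tens (L l i j) (h (e i)) (f (e j))"
    by metis
  have "\<forall>l j. \<exists>y. g (tens (E l) 1 (e j)) = tens y (h 1) (f (e j))"
    using g_tens e one by blast
  then obtain M where M: "\<And>l j. g (tens (E l) 1 (e j)) = tens (M l j) (h 1) (f (e j))"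
    by metis
  have "\<forall>l i. \<exists>y. g (tens (E l) (e i) 1) = tens y (h (e i)) (f 1)"
    using g_tens e one by blast
  then obtain N where N: "\<And>l i. g (tens (E l) (e i) 1) = tens (N l i) (h (e i)) (f 1)"
    by metis
  define H where "H = (\<chi> a i. h (e i) $ a)"
  define F where "F = (\<chi> b j. f (e j) $ b)"
  have H: "invertible H"
    unfolding H_def using h(2) e by (intro invertible_left_directions[OF lin surj]) (simp add: e_def)
  have F: "invertible F"
    unfolding F_def using f(2) e by (intro invertible_right_directions[OF lin surj]) (simp add: e_def)
  have sum_middle: "(\<Sum>i\<in>UNIV. tens x (e i) v) = tens x 1 v" for x :: "complex ^ 'm" and v
    unfolding e_def by (rule tens_sum_middle[symmetric])
  have sum_right: "(\<Sum>j\<in>UNIV. tens x u (e j)) = tens x u 1" for x :: "complex ^ 'm" and u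
    unfolding e_def by (rule tens_sum_right[symmetric])
  \<comment> \<open>\<open>c\<close> and \<open>d\<close> are the coordinates of \<open>h 1\<close>
    and \<open>f 1\<close> in the bases formed by the columns of \<open>H\<close> and
    \<open>F\<close>.\<close>
  obtain c where c: "H *v c = h 1"
    using H by (metis invertible_eq_bij bij_is_surj surjD)
  obtain d where d: "F *v d = f 1"
    using F by (metis invertible_eq_bij bij_is_surj surjD)
  \<comment> \<open>Compare the images of \<open>x \<otimes> 1 \<otimes> e\<^sub>j\<close> and \<open>\<Sum>\<^sub>i x \<otimes> e\<^sub>i \<otimes> e\<^sub>j\<close>, where \<open>1\<close> is the all-ones vector.\<close>
  have LM: "L l i j $ k = M l j $ k * c $ i" for l i j k
  proof -
    obtain b where b: "f (e j) $ b \<noteq> 0"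
      using f(1)[OF e] by (auto simp: vec_eq_iff)
    have eq: "tens (M l j) (h 1) (f (e j)) = (\<Sum>i\<in>UNIV. tens (L l i j) (h (e i)) (f (e j)))"
      using linear_sum[OF lin, of "\<lambda>i. tens (E l) (e i) (e j)" UNIV]
      by (simp only: L M sum_middle)
    have "H *v (\<chi> i. L l i j $ k - M l j $ k * c $ i) = 0"
    proof -
      have "(\<Sum>i\<in>UNIV. H $ a $ i * L l i j $ k) - M l j $ k * (H *v c) $ a = 0" for a
      proof -
        have "M l j $ k * h 1 $ a * f (e j) $ b
            = (\<Sum>i\<in>UNIV. L l i j $ k * h (e i) $ a) * f (e j) $ b"
          using arg_cong[OF eq, of "\<lambda>X. X $ k $ a $ b"] by (simp add: sum_distrib_right)
        then show ?thesis
          unfolding c using b by (simp add: H_def mult.commute)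
      qed
      then show ?thesis
        by (simp add: vec_eq_iff matrix_vector_mult_def algebra_simps sum_subtractf sum_distrib_left)
    qed
    from invertible_ker[OF H this] show ?thesis
      by (simp add: vec_eq_iff)
  qed
  \<comment> \<open>The same comparison in the last factor.\<close>
  have LN: "L l i j $ k = N l i $ k * d $ j" for l i j k
  proof -
    obtain a where a: "h (e i) $ a \<noteq> 0"
      using h(1)[OF e] by (auto simp: vec_eq_iff)
    have eq: "tens (N l i) (h (e i)) (f 1) = (\<Sum>j\<in>UNIV. tens (L l i j) (h (e i)) (f (e j)))"
      using linear_sum[OF lin, of "\<lambda>j. tens (E l) (e i) (e j)" UNIV]
      by (simp only: L N sum_right)
    have "F *v (\<chi> j. L l i j $ k - N l i $ k * d $ j) = 0"
    proof -
      have "(\<Sum>j\<in>UNIV. F $ b $ j * L l i j $ k) - N l i $ k * (F *v d) $ b = 0" for b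
      proof -
        have "h (e i) $ a * (N l i $ k * f 1 $ b)
            = h (e i) $ a * (\<Sum>j\<in>UNIV. L l i j $ k * f (e j) $ b)"
          using arg_cong[OF eq, of "\<lambda>X. X $ k $ a $ b"] by (simp add: sum_distrib_left mult_ac)
        then show ?thesis
          unfolding d using a by (simp add: F_def mult.commute)
      qed
      then show ?thesis
        by (simp add: vec_eq_iff matrix_vector_mult_def algebra_simps sum_subtractf sum_distrib_left)
    qed
    from invertible_ker[OF F this] show ?thesis
      by (simp add: vec_eq_iff)
  qed
  define l0 :: 'm where "l0 = undefined"
  define i0 :: 'n where "i0 = undefined"
  have Lnz: "L l i j \<noteq> 0" for l i j
  proof
    assume "L l i j = 0"
    then have "g (tens (E l) (e i) (e j)) = 0"
      by (simp add: L vec_eq_iff)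
    then have "tens (E l) (e i) (e j) $ l $ i $ j = 0"
      by (simp add: g0)
    then show False by (simp add: E_def e_def)
  qed
  have cnz: "c $ i \<noteq> 0" for i
    using Lnz[of l0 i i0] LM[of l0 i i0] by (auto simp: vec_eq_iff)
  have dnz: "d $ j \<noteq> 0" for j
    using Lnz[of l0 i0 j] LN[of l0 i0 j] by (auto simp: vec_eq_iff)
  \<comment> \<open>Fixing the middle index at \<open>i0\<close> in both formulas for
    \<open>L\<close> leaves the part that depends on \<open>l\<close> alone.\<close>
  define P :: "complex ^ 'm ^ 'm" where "P = (\<chi> k l. N l i0 $ k / c $ i0)"
  have LP: "L l i j $ k = P $ k $ l * (c $ i * d $ j)" for l i j k
  proof -
    have "N l i0 $ k * d $ j = M l j $ k * c $ i0"
      using LM[of l i0 j k] LN[of l i0 j k] by simp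
    then show ?thesis
      unfolding LM[of l i j k] using cnz[of i0] by (simp add: P_def field_simps)
  qed
  define Q where "Q = (\<chi> a i. c $ i * H $ a $ i)"
  define T where "T = (\<chi> b j. d $ j * F $ b $ j)"
  have Q: "invertible Q" and T: "invertible T"
    unfolding Q_def T_def by (rule invertible_scale_columns, rule H F, rule cnz dnz)+
  \<comment> \<open>The action multiplies by the inverse of \<open>R\<close> on the right.\<close>
  define R where "R = matrix_inv (transpose T)"
  have R: "invertible R" "matrix_inv R = transpose T"
    unfolding R_def using T by (simp_all add: invertible_matrix_inv invertible_transpose)
  have g_nth: "g X $ k $ a $ b = (\<Sum>l\<in>UNIV. P $ k $ l * (Q ** X $ l ** transpose T) $ a $ b)" for X k a b
  proof -
    have "g X = (\<Sum>l\<in>UNIV. \<Sum>i\<in>UNIV. \<Sum>j\<in>UNIV.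
        mats_scale (X $ l $ i $ j) (tens (L l i j) (h (e i)) (f (e j))))"
      by (subst mats_tens_expansion[of X])
        (simp add: linear_sum[OF lin] scale flip: E_def e_def L)
    then have "g X $ k $ a $ b = (\<Sum>l\<in>UNIV. \<Sum>i\<in>UNIV. \<Sum>j\<in>UNIV.
        X $ l $ i $ j * (L l i j $ k * h (e i) $ a * f (e j) $ b))"
      by (simp add: mats_scale_def mat_scale_def)
    also have "\<dots> = (\<Sum>l\<in>UNIV. P $ k $ l * (\<Sum>i\<in>UNIV. \<Sum>j\<in>UNIV.
        X $ l $ i $ j * (Q $ a $ i * transpose T $ j $ b)))"
      unfolding sum_distrib_left
      by (intro sum.cong refl) (simp add: LP Q_def T_def H_def F_def transpose_def mult_ac)
    finally show ?thesis
      by (simp only: matrix_triple_nth)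
  qed
  \<comment> \<open>A kernel vector of \<open>P\<close> would give a pure tensor annihilated by the
    injective map \<open>g\<close>.\<close>
  have "invertible P"
  proof (rule invertible_kerI)
    fix x assume x: "P *v x = 0"
    have "g (tens x (e i0) (e i0)) $ k $ a $ b = 0" for k a b
    proof -
      have "(Q ** tens x (e i0) (e i0) $ l ** transpose T) $ a $ b
          = x $ l * (Q ** outer (e i0) (e i0) ** transpose T) $ a $ b" for l
        by (simp add: matrix_triple_nth sum_distrib_left mult.assoc)
      then have "g (tens x (e i0) (e i0)) $ k $ a $ b
          = (P *v x) $ k * (Q ** outer (e i0) (e i0) ** transpose T) $ a $ b"
        by (simp add: g_nth matrix_vector_mult_def sum_distrib_right mult.assoc)
      then show ?thesis by (simp add: x)
    qed
    then have "g (tens x (e i0) (e i0)) = 0"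
      by (simp add: vec_eq_iff)
    then have "tens x (e i0) (e i0) $ l $ i0 $ i0 = 0" for l
      by (simp add: g0)
    then show "x = 0"
      by (simp add: e_def vec_eq_iff)
  qed
  moreover have "g = act P Q R"
    by (rule ext) (simp add: vec_eq_iff g_nth act_nth R(2))
  ultimately show ?thesis
    unfolding G_nm_def using Q R(1) by blast
qed


section \<open>The groups\<close>

text \<open>Inversion reverses products, which compensates for \<open>R\<close> acting from the
  right; the rest is interchange of finite sums.\<close>

lemma act_act:
  assumes "invertible R" "invertible R'"
  shows "act P Q R (act P' Q' R' X) = act (P ** P') (Q ** Q') (R ** R') X"
proof -
  have inv: "matrix_inv (R ** R') = matrix_inv R' ** matrix_inv R"
  proof (rule matrix_inv_eqI)
    have "R ** R' ** (matrix_inv R' ** matrix_inv R) = R ** (R' ** matrix_inv R') ** matrix_inv R"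
      by (simp only: matrix_mul_assoc)
    then show "R ** R' ** (matrix_inv R' ** matrix_inv R) = mat 1"
      using assms by (simp add: matrix_inv_works)
    have "matrix_inv R' ** matrix_inv R ** (R ** R') = matrix_inv R' ** (matrix_inv R ** R) ** R'"
      by (simp only: matrix_mul_assoc)
    then show "matrix_inv R' ** matrix_inv R ** (R ** R') = mat 1"
      using assms by (simp add: matrix_inv_works)
  qed
  define Z where "Z m = Q ** (Q' ** X $ m ** matrix_inv R') ** matrix_inv R" for m
  have "(Q ** act P' Q' R' X $ l ** matrix_inv R) $ a $ b = (\<Sum>m\<in>UNIV. P' $ l $ m * Z m $ a $ b)" for l a b
  proof -
    have "(Q ** act P' Q' R' X $ l ** matrix_inv R) $ a $ b
      = (\<Sum>i\<in>UNIV. \<Sum>j\<in>UNIV. \<Sum>m\<in>UNIV. P' $ l $ m *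
          ((Q' ** X $ m ** matrix_inv R') $ i $ j * (Q $ a $ i * matrix_inv R $ j $ b)))"
      by (simp only: matrix_triple_nth[of Q] act_nth sum_distrib_right mult.assoc)
    also have "\<dots> = (\<Sum>i\<in>UNIV. \<Sum>m\<in>UNIV. \<Sum>j\<in>UNIV. P' $ l $ m *
          ((Q' ** X $ m ** matrix_inv R') $ i $ j * (Q $ a $ i * matrix_inv R $ j $ b)))"
      by (intro sum.cong refl sum.swap)
    also have "\<dots> = (\<Sum>m\<in>UNIV. \<Sum>i\<in>UNIV. \<Sum>j\<in>UNIV. P' $ l $ m *
          ((Q' ** X $ m ** matrix_inv R') $ i $ j * (Q $ a $ i * matrix_inv R $ j $ b)))"
      by (rule sum.swap)
    finally show ?thesis
      by (simp only: Z_def matrix_triple_nth[of Q] sum_distrib_left)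
  qed
  then have lhs: "act P Q R (act P' Q' R' X) $ k $ a $ b
      = (\<Sum>l\<in>UNIV. \<Sum>m\<in>UNIV. P $ k $ l * (P' $ l $ m * Z m $ a $ b))" for k a b
    by (simp add: act_nth[of P] sum_distrib_left)
  have rhs: "act (P ** P') (Q ** Q') (R ** R') X $ k $ a $ b
      = (\<Sum>m\<in>UNIV. \<Sum>l\<in>UNIV. P $ k $ l * (P' $ l $ m * Z m $ a $ b))" for k a b
    unfolding act_nth inv
    by (simp add: Z_def matrix_mul_assoc) (simp add: matrix_matrix_mult_def[of P] sum_distrib_right mult.assoc)
  have "act P Q R (act P' Q' R' X) $ k $ a $ b
      = act (P ** P') (Q ** Q') (R ** R') X $ k $ a $ b" for k a b
    unfolding lhs rhs by (rule sum.swap)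
  then show ?thesis
    unfolding vec_eq_iff by blast
qed

lemma act_id: "act (mat 1) (mat 1) (mat 1) = (id :: ('a::finite, 'b::finite) mats \<Rightarrow> _)"
proof -
  have "matrix_inv (mat 1 :: complex ^ 'a ^ 'a) = mat 1"
    by (rule matrix_inv_eqI) simp_all
  then have "act (mat 1) (mat 1) (mat 1) X $ k $ a $ b = X $ k $ a $ b"
    for X :: "('a, 'b) mats" and k a b
    by (simp add: act_nth) (simp add: mat_def if_distrib[of "\<lambda>x. x * _"] cong: if_cong)
  then show ?thesis
    unfolding fun_eq_iff vec_eq_iff id_apply by blast
qed

lemma act_inverse:
  assumes "invertible P" "invertible Q" "invertible R"
  shows "act (matrix_inv P) (matrix_inv Q) (matrix_inv R) \<circ> act P Q R = id"
    "act P Q R \<circ> act (matrix_inv P) (matrix_inv Q) (matrix_inv R) = id"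
  using assms
  by (auto simp: fun_eq_iff act_act invertible_matrix_inv matrix_inv_works act_id)

text \<open>Mixing the components by \<open>P\<close> is a linear change of the parameter
  \<open>t\<close>; invariance of \<open>SING\<close> follows by taking determinants.\<close>

lemma pencil_act:
  "pencil (act P Q R X) t = Q ** pencil X (transpose P *v t) ** matrix_inv R"
proof -
  define S where "S = matrix_inv R"
  have "pencil (act P Q R X) t $ a $ b = (Q ** pencil X (transpose P *v t) ** S) $ a $ b" for a b
  proof -
    have "(Q ** pencil X (transpose P *v t) ** S) $ a $ b
      = (\<Sum>i\<in>UNIV. \<Sum>j\<in>UNIV. \<Sum>l\<in>UNIV. (transpose P *v t) $ l * (X $ l $ i $ j * (Q $ a $ i * S $ j $ b)))"
      by (simp only: matrix_triple_nth pencil_nth sum_distrib_right mult.assoc)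
    also have "\<dots> = (\<Sum>i\<in>UNIV. \<Sum>l\<in>UNIV. \<Sum>j\<in>UNIV. (transpose P *v t) $ l * (X $ l $ i $ j * (Q $ a $ i * S $ j $ b)))"
      by (intro sum.cong refl sum.swap)
    also have "\<dots> = (\<Sum>l\<in>UNIV. \<Sum>i\<in>UNIV. \<Sum>j\<in>UNIV. (transpose P *v t) $ l * (X $ l $ i $ j * (Q $ a $ i * S $ j $ b)))"
      by (rule sum.swap)
    also have "\<dots> = (\<Sum>l\<in>UNIV. (transpose P *v t) $ l * (Q ** X $ l ** S) $ a $ b)"
      by (simp only: matrix_triple_nth sum_distrib_left)
    also have "\<dots> = (\<Sum>l\<in>UNIV. \<Sum>k\<in>UNIV. t $ k * (P $ k $ l * (Q ** X $ l ** S) $ a $ b))"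
      by (simp add: matrix_vector_mult_def transpose_def sum_distrib_right)
        (intro sum.cong refl, simp add: mult_ac)
    also have "\<dots> = (\<Sum>k\<in>UNIV. \<Sum>l\<in>UNIV. t $ k * (P $ k $ l * (Q ** X $ l ** S) $ a $ b))"
      by (rule sum.swap)
    also have "\<dots> = pencil (act P Q R X) t $ a $ b"
      by (simp only: pencil_nth act_nth S_def sum_distrib_left)
    finally show ?thesis ..
  qed
  then show ?thesis
    by (simp add: vec_eq_iff S_def)
qed

lemma act_G_nm: "invertible P \<Longrightarrow> invertible Q \<Longrightarrow> invertible R \<Longrightarrow> act P Q R \<in> G_nm"
  unfolding G_nm_def by blast

lemma G_nm_obtain_inverse:
  assumes "g \<in> G_nm"
  obtains g' where "g' \<in> G_nm" "g' \<circ> g = id" "g \<circ> g' = id"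
proof -
  obtain P Q R where g: "g = act P Q R" and inv: "invertible P" "invertible Q" "invertible R"
    using assms by (auto simp: G_nm_def)
  show thesis
  proof (rule that)
    show "act (matrix_inv P) (matrix_inv Q) (matrix_inv R) \<in> G_nm"
      by (intro act_G_nm invertible_matrix_inv(1) inv)
  qed (use act_inverse[OF inv] g in auto)
qed

lemma G_nm_comp:
  assumes "g \<in> G_nm" "h \<in> G_nm"
  shows "g \<circ> h \<in> G_nm"
proof -
  obtain P Q R where g: "g = act P Q R" and inv: "invertible P" "invertible Q" "invertible R"
    using assms(1) by (auto simp: G_nm_def)
  obtain P' Q' R' where h: "h = act P' Q' R'" and inv': "invertible P'" "invertible Q'" "invertible R'"
    using assms(2) by (auto simp: G_nm_def)
  have "g \<circ> h = act (P ** P') (Q ** Q') (R ** R')"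
    by (simp add: fun_eq_iff g h act_act inv inv')
  then show ?thesis
    using inv inv' by (simp add: act_G_nm invertible_mult)
qed

lemma invertible_mat_1: "invertible (mat 1 :: 'a::field ^ 'n ^ 'n)"
  by (simp add: invertible_det_nz)

lemma id_G_nm: "id \<in> G_nm"
  using act_G_nm[OF invertible_mat_1 invertible_mat_1 invertible_mat_1] by (simp add: act_id)

lemma act_linear: "Vector_Spaces.linear mats_scale mats_scale (act P Q R)"
  unfolding linear_mats_iff
  by (simp add: vec_eq_iff act_nth matrix_triple_nth mats_scale_def mat_scale_def distrib_left distrib_right
      sum.distrib sum_distrib_left mult_ac)

lemma G_nm_carrier: "G_nm \<subseteq> carrier GL_mats"
proof
  fix g :: "('n::finite, 'm::finite) mats \<Rightarrow> ('n, 'm) mats"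
  assume g: "g \<in> G_nm"
  then obtain g' where "g' \<circ> g = id" "g \<circ> g' = id"
    using G_nm_obtain_inverse by blast
  then have "bij g" by (rule o_bij)
  then show "g \<in> carrier GL_mats"
    using g act_linear by (auto simp: GL_mats_def G_nm_def)
qed

lemma G_nm_SING:
  assumes "g \<in> G_nm" "X \<in> SING"
  shows "g X \<in> SING"
  using assms by (auto simp: G_nm_def SING_iff pencil_act det_mul)

lemma G_nm_symmetries: "G_nm \<subseteq> symmetries SING"
proof
  fix g :: "('n::finite, 'm::{finite,linorder}) mats \<Rightarrow> ('n, 'm) mats"
  assume g: "g \<in> G_nm"
  obtain g' where g': "g' \<in> G_nm" "g' \<circ> g = id" "g \<circ> g' = id"
    using G_nm_obtain_inverse[OF g] .
  have "X \<in> g ` SING" if "X \<in> SING" for X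
  proof (rule image_eqI)
    show "X = g (g' X)"
      using g'(3) by (metis comp_apply id_apply)
    show "g' X \<in> SING"
      using G_nm_SING[OF g'(1) that] .
  qed
  then have "g ` SING = SING"
    using G_nm_SING[OF g] by blast
  then show "g \<in> symmetries SING"
    using g G_nm_carrier by (auto simp: symmetries_def)
qed

lemma \<tau>_comp_\<tau>: "\<tau> \<circ> \<tau> = id"
  by (simp add: fun_eq_iff \<tau>_\<tau>)

lemma \<tau>_symmetries:
  "\<tau> \<in> symmetries (SING :: ('n::finite, 'm::{finite,linorder}) mats set)"
proof -
  have "pencil (\<tau> X) t = transpose (pencil X t)" for X :: "('n, 'm) mats" and t
    by (simp add: vec_eq_iff pencil_nth \<tau>_nth transpose_def)
  then have SING: "\<tau> X \<in> SING" if "X \<in> SING" for X :: "('n, 'm) mats"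
    using that by (simp add: SING_iff)
  then have "\<tau> ` SING = (SING :: ('n, 'm) mats set)"
    by (metis (no_types, lifting) \<tau>_\<tau> image_eqI image_subsetI subsetI subset_antisym)
  moreover have "bij (\<tau> :: ('n, 'm) mats \<Rightarrow> _)"
    by (rule o_bij[OF \<tau>_comp_\<tau> \<tau>_comp_\<tau>])
  moreover have "Vector_Spaces.linear mats_scale mats_scale (\<tau> :: ('n, 'm) mats \<Rightarrow> _)"
    unfolding linear_mats_iff
    by (simp add: vec_eq_iff \<tau>_nth mats_scale_def mat_scale_def)
  ultimately show ?thesis
    by (simp add: symmetries_def GL_mats_def)
qed

text \<open>Transposing Q X R^{-1} exchanges the roles of \<open>Q\<close> and the inverse of
  \<open>R\<close>, so \<open>\<tau>\<close> normalizes \<open>G_nm\<close>.\<close>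

lemma \<tau>_comp_G_nm:
  assumes "g \<in> G_nm"
  obtains g' where "g' \<in> G_nm" "\<tau> \<circ> g = g' \<circ> \<tau>"
proof -
  obtain P Q R where g: "g = act P Q R" and inv: "invertible P" "invertible Q" "invertible R"
    using assms by (auto simp: G_nm_def)
  define Q' where "Q' = transpose (matrix_inv R)"
  define R' where "R' = matrix_inv (transpose Q)"
  have R': "matrix_inv R' = transpose Q"
    unfolding R'_def using inv by (simp add: invertible_matrix_inv invertible_transpose)
  show thesis
  proof (rule that)
    show "act P Q' R' \<in> G_nm"
      using inv by (simp add: act_G_nm Q'_def R'_def invertible_matrix_inv invertible_transpose)
    have "\<tau> (act P Q R X) $ k $ a $ b = act P Q' R' (\<tau> X) $ k $ a $ b" for X k a b
    proof -
      have "(Q ** X $ l ** matrix_inv R) $ b $ a = (Q' ** \<tau> X $ l ** matrix_inv R') $ a $ b" for l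
        unfolding R' Q'_def matrix_triple_nth
        by (subst sum.swap) (simp add: \<tau>_nth transpose_def mult_ac)
      then show ?thesis
        by (simp add: \<tau>_nth act_nth)
    qed
    then show "\<tau> \<circ> g = act P Q' R' \<circ> \<tau>"
      by (simp add: g fun_eq_iff vec_eq_iff)
  qed
qed

section \<open>Subgroups and the full symmetry group\<close>

lemma GL_mats_ops [simp]: "x \<otimes>\<^bsub>GL_mats\<^esub> y = x \<circ> y" "\<one>\<^bsub>GL_mats\<^esub> = id"
  by (simp_all add: GL_mats_def)

lemma subgroup_symmetries: "subgroup (symmetries S) GL_mats"
proof (rule group.subgroupI[OF group_GL_mats])
  show "symmetries S \<subseteq> carrier GL_mats"
    by (auto simp: symmetries_def)
  have "id \<in> symmetries S"
    using monoid.one_closed[OF group.is_monoid[OF group_GL_mats]] by (auto simp: symmetries_def)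
  then show "symmetries S \<noteq> {}" by blast
next
  fix g assume g: "g \<in> symmetries S"
  then have car: "g \<in> carrier GL_mats" and im: "g ` S = S"
    by (auto simp: symmetries_def)
  let ?h = "inv\<^bsub>GL_mats\<^esub> g"
  have "?h \<circ> g = id"
    using group.l_inv[OF group_GL_mats car] by simp
  then have "?h ` S = S"
    using im by (metis image_comp image_id id_apply)
  then show "?h \<in> symmetries S"
    using group.inv_closed[OF group_GL_mats car] by (simp add: symmetries_def)
next
  fix g h assume gh: "g \<in> symmetries S" "h \<in> symmetries S"
  then have "(g \<circ> h) ` S = S"
    by (simp only: image_comp[symmetric] symmetries_def mem_Collect_eq)
  then show "g \<otimes>\<^bsub>GL_mats\<^esub> h \<in> symmetries S"
    using gh monoid.m_closed[OF group.is_monoid[OF group_GL_mats], of g h]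
    by (simp only: symmetries_def mem_Collect_eq GL_mats_ops)
qed

lemma subgroup_GL_matsI:
  assumes "H \<subseteq> S" "subgroup S GL_mats" "id \<in> H"
    and "\<And>g h. g \<in> H \<Longrightarrow> h \<in> H \<Longrightarrow> g \<circ> h \<in> H"
    and "\<And>g. g \<in> H \<Longrightarrow> \<exists>h\<in>H. h \<circ> g = id"
  shows "subgroup H (GL_mats\<lparr>carrier := S\<rparr>)"
proof -
  have K: "group (GL_mats\<lparr>carrier := S\<rparr>)"
    by (rule subgroup.subgroup_is_group[OF assms(2) group_GL_mats])
  show ?thesis
  proof (rule group.subgroupI[OF K])
    fix g assume g: "g \<in> H"
    then obtain h where h: "h \<in> H" "h \<circ> g = id"
      using assms(5) by blast
    have "inv\<^bsub>GL_mats\<lparr>carrier := S\<rparr>\<^esub> g = h"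
      using g h assms(1) by (intro group.inv_equality[OF K]) auto
    then show "inv\<^bsub>GL_mats\<lparr>carrier := S\<rparr>\<^esub> g \<in> H"
      using h by simp
  qed (use assms in auto)
qed

lemma r_coset_\<tau>: "G_nm #>\<^bsub>GL_mats\<^esub> \<tau> = (\<lambda>g. g \<circ> \<tau>) ` G_nm"
  by (auto simp: r_coset_def)

text \<open>Either \<open>g\<close> or \<open>\<tau> \<circ> g\<close> keeps sides and lies in
  \<open>G_nm\<close>; in the second case \<open>\<tau>\<close> is moved past \<open>G_nm\<close> to
  the right.\<close>

lemma symmetries_SING:
  "symmetries (SING :: ('n::finite, 'm::{finite,linorder}) mats set)
    = G_nm \<union> (\<lambda>g. g \<circ> \<tau>) ` G_nm"
proof (intro equalityI subsetI)
  fix g :: "('n, 'm) mats \<Rightarrow> ('n, 'm) mats"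
  assume g: "g \<in> symmetries SING"
  have \<tau>g: "\<tau> \<circ> g \<in> symmetries SING"
    using subgroup.m_closed[OF subgroup_symmetries \<tau>_symmetries g] by simp
  show "g \<in> G_nm \<union> (\<lambda>g. g \<circ> \<tau>) ` G_nm"
  proof (cases "keeps_sides g")
    case True
    then show ?thesis
      using keeps_sides_G_nm g by (auto simp: symmetries_def)
  next
    case False
    then have "keeps_sides (\<tau> \<circ> g)"
      using symmetry_keeps_sides[OF g] by blast
    then have "\<tau> \<circ> g \<in> G_nm"
      using keeps_sides_G_nm \<tau>g by (auto simp: symmetries_def)
    then obtain g' where g': "g' \<in> G_nm" "\<tau> \<circ> (\<tau> \<circ> g) = g' \<circ> \<tau>"
      by (rule \<tau>_comp_G_nm)
    then have "g = g' \<circ> \<tau>"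
      by (simp add: \<tau>_comp_\<tau> flip: comp_assoc)
    then show ?thesis
      using g'(1) by blast
  qed
next
  fix g :: "('n, 'm) mats \<Rightarrow> ('n, 'm) mats"
  assume "g \<in> G_nm \<union> (\<lambda>g. g \<circ> \<tau>) ` G_nm"
  then show "g \<in> symmetries SING"
    using G_nm_symmetries subgroup.m_closed[OF subgroup_symmetries _ \<tau>_symmetries] by force
qed

section \<open>The semidirect product\<close>

lemma left_space_not_subset_right_space:
  assumes n: "CARD('n::finite) \<ge> 2"
  shows "\<not> (left_space 1 :: ('n, 'm::finite) mats set) \<subseteq> right_space w"
proof
  assume sub: "(left_space 1 :: ('n, 'm) mats set) \<subseteq> right_space w"
  obtain a b :: 'n where ab: "b \<noteq> a" using exists_other_index[OF n] .
  have *: "\<exists>y. \<forall>j. axis i 1 $ j = y * w $ j" for i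
  proof -
    have "((\<chi> k. outer 1 (axis i 1)) :: ('n, 'm) mats) \<in> left_space 1"
      by (rule left_space_I[of _ _ "\<lambda>k. axis i 1"]) simp
    then obtain y where y: "\<And>k. ((\<chi> k. outer 1 (axis i 1)) :: ('n, 'm) mats) $ k = outer (y k) w"
      using sub right_space_E by blast
    have "axis i 1 $ j = y undefined $ undefined * w $ j" for j
      using arg_cong[OF y[of undefined], of "\<lambda>M. M $ undefined $ j"] by simp
    then show ?thesis by blast
  qed
  obtain y where y: "\<And>j. axis a 1 $ j = y * w $ j" using *[of a] by blast
  obtain z where z: "\<And>j. axis b 1 $ j = z * w $ j" using *[of b] by blast
  show False
    \<comment> \<open>Two different unit vectors cannot both be multiples of
      \<open>w\<close>.\<close>
    using y[of a] y[of b] z[of a] z[of b] ab by (auto simp: axis_def)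
qed

text \<open>Members of \<open>G_nm\<close> map right spaces into right spaces, whereas
  \<open>\<tau>\<close> maps \<open>right_space 1\<close> onto \<open>left_space 1\<close>.\<close>

lemma \<tau>_not_G_nm:
  assumes n: "CARD('n::finite) \<ge> 2"
  shows "(\<tau> :: ('n, 'm::finite) mats \<Rightarrow> _) \<notin> G_nm"
proof
  assume "(\<tau> :: ('n, 'm) mats \<Rightarrow> _) \<in> G_nm"
  then obtain P Q R where \<tau>: "(\<tau> :: ('n, 'm) mats \<Rightarrow> _) = act P Q R"
    by (auto simp: G_nm_def)
  define w where "w = transpose (matrix_inv R) *v 1"
  have "act P Q R X \<in> right_space w" if X: "X \<in> right_space 1" for X
  proof -
    obtain y where y: "\<And>k. X $ k = outer (y k) 1"
      using right_space_E[OF X] by blast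
    have "(Q ** X $ l ** matrix_inv R) $ a $ b = (Q *v y l) $ a * w $ b" for l a b
      by (simp add: matrix_triple_nth y w_def matrix_vector_mult_def transpose_def
          sum_product mult_ac) (rule sum.swap)
    then have "act P Q R X $ k = outer (\<chi> a. \<Sum>l\<in>UNIV. P $ k $ l * (Q *v y l) $ a) w" for k
      by (simp add: vec_eq_iff act_nth sum_distrib_right mult.assoc)
    then show ?thesis
      by (rule right_space_I)
  qed
  then have "\<tau> ` right_space 1 \<subseteq> (right_space w :: ('n, 'm) mats set)"
    unfolding \<tau> by blast
  then show False
    using left_space_not_subset_right_space[where 'm='m, OF n] by (simp add: \<tau>_right_space)
qed

lemma \<tau>_eq_id:
  assumes "\<not> CARD('n::finite) \<ge> 2"
  shows "(\<tau> :: ('n, 'm::finite) mats \<Rightarrow> _) = id"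
proof -
  have "CARD('n) = 1"
    using assms zero_less_card_finite[where 'a='n] by linarith
  then have "a = b" for a b :: 'n
    by (metis UNIV_I card_1_singletonE singletonD)
  then have "\<tau> X $ k $ a $ b = X $ k $ a $ b" for X :: "('n, 'm) mats" and k a b
    unfolding \<tau>_nth by metis
  then show ?thesis
    by (simp add: fun_eq_iff vec_eq_iff)
qed

lemma generate_\<tau>: "generate GL_mats {\<tau>} = {id, \<tau> :: ('n::finite, 'm::{finite,linorder}) mats \<Rightarrow> _}"
proof
  have car: "\<tau> \<in> carrier (GL_mats :: (('n, 'm) mats \<Rightarrow> _) monoid)"
    using \<tau>_symmetries by (auto simp: symmetries_def)
  have "subgroup {id, \<tau>} (GL_mats\<lparr>carrier := carrier GL_mats\<rparr> :: (('n, 'm) mats \<Rightarrow> _) monoid)"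
    using car G_nm_carrier id_G_nm \<tau>_comp_\<tau>
    by (intro subgroup_GL_matsI group.subgroup_self[OF group_GL_mats]) auto
  then have "subgroup {id, \<tau>} (GL_mats :: (('n, 'm) mats \<Rightarrow> _) monoid)"
    by simp
  then show "generate GL_mats {\<tau>} \<subseteq> {id, \<tau> :: ('n, 'm) mats \<Rightarrow> _}"
    by (intro group.generate_subgroup_incl[OF group_GL_mats]) auto
  show "{id, \<tau> :: ('n, 'm) mats \<Rightarrow> _} \<subseteq> generate GL_mats {\<tau>}"
    using generate.one[of GL_mats "{\<tau>}"] generate.incl[of \<tau> "{\<tau>}" GL_mats] by auto
qed

text \<open>Every symmetry is a member of \<open>G_nm\<close>, possibly followed on the right by
  \<open>\<tau>\<close>, and both normalize \<open>G_nm\<close>.\<close>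

lemma G_nm_normal:
  "G_nm \<lhd> (GL_mats\<lparr>carrier := symmetries (SING :: ('n::finite, 'm::{finite,linorder}) mats set)\<rparr>)"
    (is "_ \<lhd> ?K")
proof -
  interpret K: group ?K
    by (rule subgroup.subgroup_is_group[OF subgroup_symmetries group_GL_mats])
  have sub: "subgroup G_nm ?K"
    using G_nm_obtain_inverse
    by (intro subgroup_GL_matsI subgroup_symmetries G_nm_symmetries id_G_nm G_nm_comp) blast+
  have "\<exists>h'\<in>G_nm. x \<circ> h = h' \<circ> x" if x: "x \<in> carrier ?K" and h: "h \<in> G_nm" for x h
  proof -
    have *: "\<exists>h'\<in>G_nm. g \<circ> h = h' \<circ> g" if g: "g \<in> G_nm" and h: "h \<in> G_nm" for g h
    proof -
      obtain g' where g': "g' \<in> G_nm" "g' \<circ> g = id"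
        using G_nm_obtain_inverse[OF g] by blast
      have "g \<circ> h = (g \<circ> h \<circ> g') \<circ> g"
        by (simp add: comp_assoc g'(2))
      then show ?thesis
        using G_nm_comp g h g'(1) by blast
    qed
    have "x \<in> G_nm \<or> (\<exists>g\<in>G_nm. x = g \<circ> \<tau>)"
      using x by (auto simp: symmetries_SING)
    then show ?thesis
    proof
      assume "\<exists>g\<in>G_nm. x = g \<circ> \<tau>"
      then obtain g where g: "g \<in> G_nm" "x = g \<circ> \<tau>" by blast
      obtain h1 where h1: "h1 \<in> G_nm" "\<tau> \<circ> h = h1 \<circ> \<tau>"
        using \<tau>_comp_G_nm[OF h] .
      obtain h2 where h2: "h2 \<in> G_nm" "g \<circ> h1 = h2 \<circ> g"
        using *[OF g(1) h1(1)] by blast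
      have "x \<circ> h = (g \<circ> h1) \<circ> \<tau>"
        by (simp add: g(2) comp_assoc h1(2))
      also have "\<dots> = h2 \<circ> x"
        by (simp add: h2(2) g(2) comp_assoc)
      finally show ?thesis using h2(1) by blast
    qed (use * h in blast)
  qed
  then have "x \<otimes>\<^bsub>?K\<^esub> h \<otimes>\<^bsub>?K\<^esub> inv\<^bsub>?K\<^esub> x \<in> G_nm"
    if x: "x \<in> carrier ?K" and h: "h \<in> G_nm" for x h
  proof -
    obtain h' where h': "h' \<in> G_nm" "x \<circ> h = h' \<circ> x"
      using \<open>\<And>x h. x \<in> carrier ?K \<Longrightarrow> h \<in> G_nm \<Longrightarrow> \<exists>h'\<in>G_nm. x \<circ> h = h' \<circ> x\<close> x h by blast
    have "h' \<in> carrier ?K"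
      using h'(1) subgroup.subset[OF sub] by blast
    have "x \<otimes>\<^bsub>?K\<^esub> h \<otimes>\<^bsub>?K\<^esub> inv\<^bsub>?K\<^esub> x = h' \<otimes>\<^bsub>?K\<^esub> x \<otimes>\<^bsub>?K\<^esub> inv\<^bsub>?K\<^esub> x"
      using h'(2) by simp
    also have "\<dots> = h'"
      using \<open>h' \<in> carrier ?K\<close> x K.m_assoc K.r_inv K.r_one K.inv_closed by metis
    finally show ?thesis using h'(1) by simp
  qed
  then show ?thesis
    unfolding K.normal_inv_iff using sub by blast
qed

lemma two_element_group_iso:
  assumes "\<tau> \<noteq> (id :: ('n::finite, 'm::finite) mats \<Rightarrow> _)"
  shows "GL_mats\<lparr>carrier := {id, \<tau> :: ('n, 'm) mats \<Rightarrow> _}\<rparr> \<cong> integer_mod_group 2"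
proof (rule is_isoI)
  let ?\<phi> = "\<lambda>g :: ('n, 'm) mats \<Rightarrow> ('n, 'm) mats. if g = id then 0 else 1 :: int"
  have "{0..<2} = {0, 1 :: int}" by auto
  then show "?\<phi> \<in> iso (GL_mats\<lparr>carrier := {id, \<tau>}\<rparr>) (integer_mod_group 2)"
    using assms \<tau>_comp_\<tau>
    by (auto simp: iso_def hom_def bij_betw_def carrier_integer_mod_group inj_on_def)
qed

theorem theorem1p13:
  shows "symmetries (SING :: ('n::finite, 'm::{finite,linorder}) mats set)
      = G_nm \<union> (G_nm #>\<^bsub>GL_mats\<^esub> \<tau>)
    \<and> internal_semidirect_product
        (GL_mats\<lparr>carrier := symmetries (SING :: ('n, 'm) mats set)\<rparr>)
        G_nm (generate GL_mats {\<tau>})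
    \<and> (CARD('n) \<ge> 2 \<longrightarrow>
        GL_mats\<lparr>carrier := generate GL_mats {\<tau> :: ('n, 'm) mats \<Rightarrow> ('n, 'm) mats}\<rparr>
          \<cong> integer_mod_group 2)"
proof (intro conjI impI)
  show "symmetries (SING :: ('n, 'm) mats set) = G_nm \<union> (G_nm #>\<^bsub>GL_mats\<^esub> \<tau>)"
    unfolding symmetries_SING r_coset_\<tau> ..
next
  let ?K = "GL_mats\<lparr>carrier := symmetries (SING :: ('n, 'm) mats set)\<rparr>"
  have "subgroup {id, \<tau>} ?K"
    using \<tau>_symmetries G_nm_symmetries id_G_nm \<tau>_comp_\<tau>
    by (intro subgroup_GL_matsI subgroup_symmetries) auto
  \<comment> \<open>For n \<ge> 2 the transposition lies outside \<open>G_nm\<close>; for n = 1 it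
    is the identity.\<close>
  moreover have "G_nm \<inter> {id, \<tau> :: ('n, 'm) mats \<Rightarrow> _} = {id}"
    using id_G_nm \<tau>_not_G_nm[where 'n='n and 'm='m] \<tau>_eq_id[where 'n='n and 'm='m] by blast
  moreover have "G_nm <#>\<^bsub>?K\<^esub> {id, \<tau>} = carrier ?K"
    unfolding set_mult_def by (auto simp: symmetries_SING)
  ultimately show "internal_semidirect_product ?K G_nm (generate GL_mats {\<tau>})"
    unfolding internal_semidirect_product_def generate_\<tau> using G_nm_normal by simp
next
  assume n: "CARD('n) \<ge> 2"
  have "\<tau> \<noteq> (id :: ('n, 'm) mats \<Rightarrow> _)"
    using \<tau>_not_G_nm[OF n] id_G_nm by metis
  then show "GL_mats\<lparr>carrier := generate GL_mats {\<tau> :: ('n, 'm) mats \<Rightarrow> ('n, 'm) mats}\<rparr>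
      \<cong> integer_mod_group 2"
    unfolding generate_\<tau> by (rule two_element_group_iso)
qed


end
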